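(* Let $\phi_1$ and $\phi_2$ be discrete-time random dynamical systems over the same driving flow $\theta$, with state spaces $X_1$ and $X_2$ respectively, which are topologically equivalent via $\alpha:\Omega\times X_1\to X_2$. If $S(\omega)$ is a random isolated invariant set with respect to $\phi_1$, then $\alpha(\omega,S(\omega))$ is a random isolated invariant set with respect to $\phi_2$ and $$h(S(\omega),\phi_1)=h(\alpha(\omega,S(\omega)),\phi_2).$$
   Context: Setting. $(\Omega,\mathcal F,\mathbb P)$ is a probability space, state spaces are locally compact complete metric spaces, and the time set is $\mathbb Z$. A driving flow $(\theta_n)_{n\in\mathbb Z}$ on $\Omega$ is a flow such that $(n,\omega)\mapsto\theta_n\omega$ is measurable and $\theta_n\mathbb P=\mathbb P$ for all $n$; write $\theta=\theta_1$. A discrete-time random dynamical system (RDS) over $\theta$ with state space $X$ is a measurable map $\phi:\mathbb Z\times\Omega\times X\to X$, continuous in $x$ for every $n,\omega$, such that, with $\phi(n,\omega)=\phi(n,\omega,\cdot)$, $\phi(0,\omega)=id_X$ and $\phi(n+m,\omega)=\phi(n,\theta_m\omega)\circ\phi(m,\omega)$ for all $n,m\in\mathbb Z$, $\omega\in\Omega$. $\phi$ is identified with its time-one map (random homeomorphism) $\varphi(\omega)=\phi(1,\omega)$, also written $\varphi(\omega,x)$. Random sets. $S(\omega)$ denotes the random set $\omega\mapsto S(\omega)\subset X$; a random compact set is a map $\omega\mapsto N(\omega)$ with compact values such that $\omega\mapsto d(x,N(\omega))$ is measurable for each $x\in X$. Relations between random sets are understood fiberwise in $\omega$; $int$ and $cl$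 denote fiberwise interior and closure. Isolated invariant sets. For a random compact set $N(\omega)$, $Inv N(\omega)=\{x\in N(\omega):\phi(n,\omega,x)\in N(\theta_n\omega)\ \forall n\in\mathbb Z\}$. $N(\omega)$ is a random isolating neighborhood if $Inv N(\omega)\subset int N(\omega)$. $S(\omega)$ is a random isolated invariant set if $S(\omega)=Inv N(\omega)$ for some random isolating neighborhood $N(\omega)$; then $N(\omega)$ is called a random isolating neighborhood of $S(\omega)$. Filtration pairs. The exit set of $N(\omega)$ is $N^-(\omega)=\{x\in N(\omega):\varphi(\omega,x)\notin int N(\theta\omega)\}$. Let $N(\omega)$ be a random isolating neighborhood, $L(\omega)\subset N(\omega)$ a random compact set, $N(\omega)=cl(int N(\omega))$, $L(\omega)=cl(int L(\omega))$, and $S(\omega)$ a random isolated invariant set inside $N(\omega)$. $P=(N(\omega),L(\omega))$ is a random filtration pair for $S(\omega)$ if (i) $cl(N(\omega)\setminus L(\omega))$ is a random isolating neighborhood of $S(\omega)$; (ii) $L(\omega)$ is a random neighborhood of $N^-(\omega)$ in $N(\omega)$; (iii) $\varphi(\omega,L(\omega))\cap cl(N(\theta\omega)\setminus L(\theta\omega))=\emptyset$. The random pointed space is the quotient $N_L(\omega)=N(\omega)/L(\omega)=((N(\omega)\setminus L(\omega))\cup\{[L(\omega)]\},[L(\omega)])$ (a disjoint base point $[\emptyset]$ is added if $L(\omega)=\emptyset$), with quotient map $p(\omega,\cdot):N(\omega)\to N_L(\omega)$. The associated random pointed space map $\varphi_P(\omega,\cdot):N_L(\omega)\to N_L(\theta\omega)$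 sends $x$ to $[L(\theta\omega)]$ if $x=[L(\omega)]$ or $\varphi(\omega,x)\notin N(\theta\omega)$, and to $p(\theta\omega,\varphi(\omega,x))$ otherwise. Homotopy and shift equivalence. Random maps are base-point-preserving Caratheodory functions (continuous in $x$, measurable in $\omega$). Two random maps $f(\omega,\cdot),g(\omega,\cdot):C(\omega)\to D(\theta_{n(\omega)}\omega)$ are random homotopic if there is $H(\lambda,\omega,x)$, $\lambda\in[0,1]$, with values in $D(\theta_{n(\omega)}\omega)$, continuous in $(\lambda,x)$ and measurable in $\omega$, with $H(0,\cdot,\cdot)=f$, $H(1,\cdot,\cdot)=g$; $[f]$ denotes the homotopy class. For $d(\omega,\cdot):D(\omega)\to D(\theta\omega)$, $d^m(\omega,\cdot)=d(\theta_{m-1}\omega,\cdot)\circ\cdots\circ d(\omega,\cdot)$. For random pointed spaces $C,D$ with random maps $c(\omega,\cdot):C(\omega)\to C(\theta\omega)$, $d(\omega,\cdot):D(\omega)\to D(\theta\omega)$, $(C,[c])$ and $(D,[d])$ are random shift equivalent if there are measurable nonnegative-integer-valued $n_1(\omega),n_2(\omega)$ and random homotopy classes $[r]$, $[s]$ of maps $r(\omega,\cdot):C(\omega)\to D(\theta_{n_1(\omega)}\omega)$, $s(\omega,\cdot):D(\omega)\to C(\theta_{n_2(\omega)}\omega)$ such that, up to random homotopy: (a) $r(\theta\omega,c(\omega,\cdot))=d^{\,n_1(\theta\omega)-n_1(\omega)}(\theta_{n_1(\omega)+1}\omega,\,d(\theta_{n_1(\omega)}\omega,r(\omega,\cdot)))$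 when $n_1(\theta\omega)\ge n_1(\omega)$, and $d^{\,n_1(\omega)-n_1(\theta\omega)}(\theta_{n_1(\theta\omega)+1}\omega,\,r(\theta\omega,c(\omega,\cdot)))=d(\theta_{n_1(\omega)}\omega,r(\omega,\cdot))$ when $n_1(\theta\omega)<n_1(\omega)$; (b) the same with $(r,c,d,n_1)$ replaced by $(s,d,c,n_2)$; (c) $r(\theta_{n_2(\omega)}\omega,s(\omega,\cdot))=d^{\,n_2(\omega)+n_1(\theta_{n_2(\omega)}\omega)}(\omega,\cdot)$ and $s(\theta_{n_1(\omega)}\omega,r(\omega,\cdot))=c^{\,n_1(\omega)+n_2(\theta_{n_1(\omega)}\omega)}(\omega,\cdot)$. This is an equivalence relation. Random Conley index. For a random filtration pair $P$ for $S(\omega)$, $h(S(\omega),\varphi)$ (also written $h(S(\omega),\phi)$) is the random shift equivalence class of $(N_L,[\varphi_P])$; it does not depend on the choice of $P$ (known fact). Topological equivalence. $\phi_1,\phi_2$ are topologically equivalent via $\alpha:\Omega\times X_1\to X_2$ if $x\mapsto\alpha(\omega,x)$ is a homeomorphism of $X_1$ onto $X_2$ for each $\omega$; $\omega\mapsto\alpha(\omega,x_1)$ and $\omega\mapsto\alpha^{-1}(\omega,x_2)$ are measurable for all $x_1\in X_1,x_2\in X_2$; and $\phi_2(n,\omega,\alpha(\omega,x))=\alpha(\theta_n\omega,\phi_1(n,\omega,x))$ for all $n\in\mathbb Z$, $x\in X_1$, $\omega\in\Omega$.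
   Formalization: The state spaces are additionally assumed separable; for non-separable locally compact complete metric spaces the image of a random compact set under α need not be measurable, and the claim fails. *)

theory Defs
  imports "HOL-Probability.Probability"
begin

text \<open>State spaces are locally compact complete metric spaces.  They are also separable here, which
  is the usual standing convention for random sets and Caratheodory functions: without it, the image
  of a random compact set under a random homeomorphism need not be a random compact set.\<close>

class state_space = polish_space +
  assumes compact_nbhd: "\<exists>U K. open U \<and> x \<in> U \<and> U \<subseteq> K \<and> compact K"

section \<open>Driving flows and random dynamical systems\<close>

text \<open>The sample space is \<open>space M\<close>; all fiberwise statements hold for every (not just almost
  every) sample point.\<close>

definition driving_flow :: "'w measure \<Rightarrow> (int \<Rightarrow> 'w \<Rightarrow> 'w) \<Rightarrow> bool" where
  "driving_flow M \<theta> \<longleftrightarrow>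
     prob_space M \<and>
     (\<lambda>(n, \<omega>). \<theta> n \<omega>) \<in> measurable (count_space UNIV \<Otimes>\<^sub>M M) M \<and>
     (\<forall>n. distr M M (\<theta> n) = M) \<and>
     (\<forall>\<omega>\<in>space M. \<theta> 0 \<omega> = \<omega>) \<and>
     (\<forall>n m. \<forall>\<omega>\<in>space M. \<theta> (n + m) \<omega> = \<theta> n (\<theta> m \<omega>))"

definition rds ::
  "'w measure \<Rightarrow> (int \<Rightarrow> 'w \<Rightarrow> 'w) \<Rightarrow> (int \<Rightarrow> 'w \<Rightarrow> 'x \<Rightarrow> 'x::state_space) \<Rightarrow> bool" where
  "rds M \<theta> \<phi> \<longleftrightarrow>
     (\<lambda>(n, \<omega>, x). \<phi> n \<omega> x) \<in> measurable (count_space UNIV \<Otimes>\<^sub>M (M \<Otimes>\<^sub>M borel)) borel \<and>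
     (\<forall>n. \<forall>\<omega>\<in>space M. continuous_on UNIV (\<phi> n \<omega>)) \<and>
     (\<forall>\<omega>\<in>space M. \<phi> 0 \<omega> = id) \<and>
     (\<forall>n m. \<forall>\<omega>\<in>space M. \<phi> (n + m) \<omega> = \<phi> n (\<theta> m \<omega>) \<circ> \<phi> m \<omega>)"

definition topologically_equivalent_via ::
  "'w measure \<Rightarrow> (int \<Rightarrow> 'w \<Rightarrow> 'w) \<Rightarrow> (int \<Rightarrow> 'w \<Rightarrow> 'x \<Rightarrow> 'x::state_space) \<Rightarrow>
   (int \<Rightarrow> 'w \<Rightarrow> 'y \<Rightarrow> 'y::state_space) \<Rightarrow> ('w \<Rightarrow> 'x \<Rightarrow> 'y) \<Rightarrow> bool" where
  "topologically_equivalent_via M \<theta> \<phi>\<^sub>1 \<phi>\<^sub>2 \<alpha> \<longleftrightarrow>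
     (\<forall>\<omega>\<in>space M. homeomorphism UNIV UNIV (\<alpha> \<omega>) (inv (\<alpha> \<omega>))) \<and>
     (\<forall>x. (\<lambda>\<omega>. \<alpha> \<omega> x) \<in> measurable M borel) \<and>
     (\<forall>y. (\<lambda>\<omega>. inv (\<alpha> \<omega>) y) \<in> measurable M borel) \<and>
     (\<forall>n x. \<forall>\<omega>\<in>space M. \<phi>\<^sub>2 n \<omega> (\<alpha> \<omega> x) = \<alpha> (\<theta> n \<omega>) (\<phi>\<^sub>1 n \<omega> x))"

section \<open>Random isolated invariant sets\<close>

text \<open>The distance is taken as an extended real infimum, so that the distance to the empty set is
  \<open>\<infinity>\<close> (and not \<open>0\<close>, as for \<^const>\<open>infdist\<close>): fibers may be empty.\<close>

definition random_compact :: "'w measure \<Rightarrow> ('w \<Rightarrow> 'x::state_space set) \<Rightarrow> bool" where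
  "random_compact M N \<longleftrightarrow>
     (\<forall>\<omega>\<in>space M. compact (N \<omega>)) \<and>
     (\<forall>x. (\<lambda>\<omega>. INF y\<in>N \<omega>. ereal (dist x y)) \<in> borel_measurable M)"

definition Inv ::
  "(int \<Rightarrow> 'w \<Rightarrow> 'w) \<Rightarrow> (int \<Rightarrow> 'w \<Rightarrow> 'x \<Rightarrow> 'x) \<Rightarrow> ('w \<Rightarrow> 'x set) \<Rightarrow> 'w \<Rightarrow> 'x set" where
  "Inv \<theta> \<phi> N \<omega> = {x \<in> N \<omega>. \<forall>n. \<phi> n \<omega> x \<in> N (\<theta> n \<omega>)}"

definition random_isolating_nbhd ::
  "'w measure \<Rightarrow> (int \<Rightarrow> 'w \<Rightarrow> 'w) \<Rightarrow> (int \<Rightarrow> 'w \<Rightarrow> 'x \<Rightarrow> 'x::state_space) \<Rightarrow>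
   ('w \<Rightarrow> 'x set) \<Rightarrow> bool" where
  "random_isolating_nbhd M \<theta> \<phi> N \<longleftrightarrow>
     random_compact M N \<and> (\<forall>\<omega>\<in>space M. Inv \<theta> \<phi> N \<omega> \<subseteq> interior (N \<omega>))"

definition random_isolating_nbhd_of ::
  "'w measure \<Rightarrow> (int \<Rightarrow> 'w \<Rightarrow> 'w) \<Rightarrow> (int \<Rightarrow> 'w \<Rightarrow> 'x \<Rightarrow> 'x::state_space) \<Rightarrow>
   ('w \<Rightarrow> 'x set) \<Rightarrow> ('w \<Rightarrow> 'x set) \<Rightarrow> bool" where
  "random_isolating_nbhd_of M \<theta> \<phi> S N \<longleftrightarrow>
     random_isolating_nbhd M \<theta> \<phi> N \<and> (\<forall>\<omega>\<in>space M. S \<omega> = Inv \<theta> \<phi> N \<omega>)"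

definition random_isolated_invariant ::
  "'w measure \<Rightarrow> (int \<Rightarrow> 'w \<Rightarrow> 'w) \<Rightarrow> (int \<Rightarrow> 'w \<Rightarrow> 'x \<Rightarrow> 'x::state_space) \<Rightarrow>
   ('w \<Rightarrow> 'x set) \<Rightarrow> bool" where
  "random_isolated_invariant M \<theta> \<phi> S \<longleftrightarrow> (\<exists>N. random_isolating_nbhd_of M \<theta> \<phi> S N)"

section \<open>Random pointed spaces\<close>

text \<open>The point set \<open>(N - L) \<union> {[L]}\<close> of the pointed quotient is coded in the option type, with
  base point \<^const>\<open>None\<close>.\<close>

definition quotient_proj :: "'x set \<Rightarrow> 'x \<Rightarrow> 'x option" where
  "quotient_proj L x = (if x \<in> L then None else Some x)"

text \<open>The quotient topology; if \<open>L\<close> is empty then the added base point is isolated.\<close>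

definition pointed_quotient :: "'x::topological_space set \<Rightarrow> 'x set \<Rightarrow> 'x option topology" where
  "pointed_quotient N L = topology (\<lambda>U. U \<subseteq> insert None (Some ` (N - L)) \<and>
     openin (top_of_set N) {x \<in> N. quotient_proj L x \<in> U})"

lemma openin_pointed_quotient:
  "openin (pointed_quotient N L) U \<longleftrightarrow> U \<subseteq> insert None (Some ` (N - L)) \<and>
     openin (top_of_set N) {x \<in> N. quotient_proj L x \<in> U}"
proof -
  have "istopology (\<lambda>U. U \<subseteq> insert None (Some ` (N - L)) \<and>
     openin (top_of_set N) {x \<in> N. quotient_proj L x \<in> U})"
    unfolding istopology_def
  proof (intro conjI allI impI; (elim conjE)?)
    fix S T
    assume "openin (top_of_set N) {x \<in> N. quotient_proj L x \<in> S}"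
      and "openin (top_of_set N) {x \<in> N. quotient_proj L x \<in> T}"
    then have "openin (top_of_set N)
        ({x \<in> N. quotient_proj L x \<in> S} \<inter> {x \<in> N. quotient_proj L x \<in> T})"
      by (rule openin_Int)
    then show "openin (top_of_set N) {x \<in> N. quotient_proj L x \<in> S \<inter> T}"
      by (rule back_subst[of "openin (top_of_set N)"]) auto
  next
    fix \<K>
    assume *: "\<forall>K\<in>\<K>. K \<subseteq> insert None (Some ` (N - L)) \<and>
      openin (top_of_set N) {x \<in> N. quotient_proj L x \<in> K}"
    then have "openin (top_of_set N) (\<Union>K\<in>\<K>. {x \<in> N. quotient_proj L x \<in> K})"
      by blast
    then show "openin (top_of_set N) {x \<in> N. quotient_proj L x \<in> \<Union> \<K>}"
      by (rule back_subst[of "openin (top_of_set N)"]) auto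
    show "\<Union> \<K> \<subseteq> insert None (Some ` (N - L))"
      using * by blast
  qed auto
  then show ?thesis
    by (simp add: pointed_quotient_def)
qed

lemma topspace_pointed_quotient:
  "topspace (pointed_quotient N L) = insert None (Some ` (N - L))"
proof
  show "topspace (pointed_quotient N L) \<subseteq> insert None (Some ` (N - L))"
    by (metis openin_pointed_quotient openin_topspace)
  have "{x \<in> N. quotient_proj L x \<in> insert None (Some ` (N - L))} = N"
    by (auto simp: quotient_proj_def)
  then have "openin (pointed_quotient N L) (insert None (Some ` (N - L)))"
    by (simp add: openin_pointed_quotient)
  then show "insert None (Some ` (N - L)) \<subseteq> topspace (pointed_quotient N L)"
    by (rule openin_subset)
qed

definition pointed_borel :: "'x::topological_space option measure" where
  "pointed_borel = sigma UNIV (insert {None} ((`) Some ` sets borel))"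

text \<open>A random pointed space is the fiberwise quotient of a pair of random compact sets.\<close>

type_synonym ('w, 'x) random_pair = "('w \<Rightarrow> 'x set) \<times> ('w \<Rightarrow> 'x set)"

type_synonym ('w, 'x, 'y) pointed_map = "'w \<Rightarrow> 'x option \<Rightarrow> 'y option"

definition regular_random_pair :: "'w measure \<Rightarrow> ('w, 'x::state_space) random_pair \<Rightarrow> bool" where
  "regular_random_pair M P \<longleftrightarrow>
     random_compact M (fst P) \<and> random_compact M (snd P) \<and>
     (\<forall>\<omega>\<in>space M. snd P \<omega> \<subseteq> fst P \<omega> \<and>
        fst P \<omega> = closure (interior (fst P \<omega>)) \<and>
        snd P \<omega> = closure (interior (snd P \<omega>)))"

definition fiber :: "('w, 'x::topological_space) random_pair \<Rightarrow> 'w \<Rightarrow> 'x option topology" where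
  "fiber P \<omega> = pointed_quotient (fst P \<omega>) (snd P \<omega>)"

text \<open>Measurability in \<open>\<omega>\<close> of a function with varying domains \<open>fiber C \<omega>\<close>: for every \<open>x\<close>, on the set
  of those \<open>\<omega>\<close> whose fiber contains \<open>x\<close>.  The integer \<open>n \<omega>\<close> is the time shift of the codomain.\<close>

definition random_map ::
  "'w measure \<Rightarrow> (int \<Rightarrow> 'w \<Rightarrow> 'w) \<Rightarrow> ('w, 'x::state_space) random_pair \<Rightarrow>
   ('w, 'y::state_space) random_pair \<Rightarrow> ('w \<Rightarrow> nat) \<Rightarrow> ('w, 'x, 'y) pointed_map \<Rightarrow> bool" where
  "random_map M \<theta> C D n f \<longleftrightarrow>
     (\<forall>\<omega>\<in>space M. continuous_map (fiber C \<omega>) (fiber D (\<theta> (int (n \<omega>)) \<omega>)) (f \<omega>)) \<and>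
     (\<forall>\<omega>\<in>space M. f \<omega> None = None) \<and>
     (\<forall>x. (\<lambda>\<omega>. f \<omega> x) \<in> measurable
        (restrict_space M {\<omega> \<in> space M. x \<in> topspace (fiber C \<omega>)}) pointed_borel)"

text \<open>The homotopy itself is not required to preserve base points.\<close>

definition random_homotopic ::
  "'w measure \<Rightarrow> (int \<Rightarrow> 'w \<Rightarrow> 'w) \<Rightarrow> ('w, 'x::state_space) random_pair \<Rightarrow>
   ('w, 'y::state_space) random_pair \<Rightarrow> ('w \<Rightarrow> nat) \<Rightarrow> ('w, 'x, 'y) pointed_map \<Rightarrow>
   ('w, 'x, 'y) pointed_map \<Rightarrow> bool" where
  "random_homotopic M \<theta> C D n f g \<longleftrightarrow>
     random_map M \<theta> C D n f \<and> random_map M \<theta> C D n g \<and>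
     (\<exists>H :: real \<Rightarrow> ('w, 'x, 'y) pointed_map.
        (\<forall>\<omega>\<in>space M. continuous_map
           (prod_topology (top_of_set {0..1}) (fiber C \<omega>)) (fiber D (\<theta> (int (n \<omega>)) \<omega>))
           (\<lambda>(l, x). H l \<omega> x)) \<and>
        (\<forall>l\<in>{0..1}. \<forall>x. (\<lambda>\<omega>. H l \<omega> x) \<in> measurable
           (restrict_space M {\<omega> \<in> space M. x \<in> topspace (fiber C \<omega>)}) pointed_borel) \<and>
        (\<forall>\<omega>\<in>space M. \<forall>x\<in>topspace (fiber C \<omega>). H 0 \<omega> x = f \<omega> x \<and> H 1 \<omega> x = g \<omega> x))"

definition homotopy_class ::
  "'w measure \<Rightarrow> (int \<Rightarrow> 'w \<Rightarrow> 'w) \<Rightarrow> ('w, 'x::state_space) random_pair \<Rightarrow>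
   ('w, 'x, 'x) pointed_map \<Rightarrow> ('w, 'x, 'x) pointed_map set" where
  "homotopy_class M \<theta> C c = {c'. random_homotopic M \<theta> C C (\<lambda>_. 1) c c'}"

section \<open>Random shift equivalence\<close>

primrec iter ::
  "(int \<Rightarrow> 'w \<Rightarrow> 'w) \<Rightarrow> ('w, 'x, 'x) pointed_map \<Rightarrow> nat \<Rightarrow> ('w, 'x, 'x) pointed_map" where
  "iter \<theta> d 0 \<omega> = id"
| "iter \<theta> d (Suc m) \<omega> = d (\<theta> (int m) \<omega>) \<circ> iter \<theta> d m \<omega>"

text \<open>The map \<open>r\<close> intertwines \<open>c\<close> and \<open>d\<close> up to homotopy.  The two sides have time shifts
  \<open>n (\<theta> \<omega>) + 1\<close> and \<open>n \<omega> + 1\<close>; the smaller shift is raised to the larger one by iterates of \<open>d\<close>.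
  By truncated subtraction, at most one of the two iterates is not the identity, which covers both
  of the cases \<open>n (\<theta> \<omega>) \<ge> n \<omega>\<close> and \<open>n (\<theta> \<omega>) < n \<omega>\<close>.\<close>

definition intertwines ::
  "'w measure \<Rightarrow> (int \<Rightarrow> 'w \<Rightarrow> 'w) \<Rightarrow> ('w, 'x::state_space) random_pair \<Rightarrow>
   ('w, 'x, 'x) pointed_map \<Rightarrow> ('w, 'y::state_space) random_pair \<Rightarrow> ('w, 'y, 'y) pointed_map \<Rightarrow>
   ('w \<Rightarrow> nat) \<Rightarrow> ('w, 'x, 'y) pointed_map \<Rightarrow> bool" where
  "intertwines M \<theta> C c D d n r \<longleftrightarrow>
     random_homotopic M \<theta> C D (\<lambda>\<omega>. max (n \<omega>) (n (\<theta> 1 \<omega>)) + 1)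
       (\<lambda>\<omega> x. iter \<theta> d (n \<omega> - n (\<theta> 1 \<omega>)) (\<theta> (int (n (\<theta> 1 \<omega>)) + 1) \<omega>) (r (\<theta> 1 \<omega>) (c \<omega> x)))
       (\<lambda>\<omega> x. iter \<theta> d (n (\<theta> 1 \<omega>) - n \<omega>) (\<theta> (int (n \<omega>) + 1) \<omega>) (d (\<theta> (int (n \<omega>)) \<omega>) (r \<omega> x)))"

definition random_shift_equivalent ::
  "'w measure \<Rightarrow> (int \<Rightarrow> 'w \<Rightarrow> 'w) \<Rightarrow> ('w, 'x::state_space) random_pair \<Rightarrow>
   ('w, 'x, 'x) pointed_map \<Rightarrow> ('w, 'y::state_space) random_pair \<Rightarrow> ('w, 'y, 'y) pointed_map \<Rightarrow>
   bool" where
  "random_shift_equivalent M \<theta> C c D d \<longleftrightarrow>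
     regular_random_pair M C \<and> regular_random_pair M D \<and>
     random_map M \<theta> C C (\<lambda>_. 1) c \<and> random_map M \<theta> D D (\<lambda>_. 1) d \<and>
     (\<exists>n\<^sub>1 n\<^sub>2 r s.
        n\<^sub>1 \<in> measurable M (count_space UNIV) \<and> n\<^sub>2 \<in> measurable M (count_space UNIV) \<and>
        random_map M \<theta> C D n\<^sub>1 r \<and> random_map M \<theta> D C n\<^sub>2 s \<and>
        intertwines M \<theta> C c D d n\<^sub>1 r \<and>
        intertwines M \<theta> D d C c n\<^sub>2 s \<and>
        random_homotopic M \<theta> D D (\<lambda>\<omega>. n\<^sub>2 \<omega> + n\<^sub>1 (\<theta> (int (n\<^sub>2 \<omega>)) \<omega>))
          (\<lambda>\<omega> x. r (\<theta> (int (n\<^sub>2 \<omega>)) \<omega>) (s \<omega> x))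
          (\<lambda>\<omega>. iter \<theta> d (n\<^sub>2 \<omega> + n\<^sub>1 (\<theta> (int (n\<^sub>2 \<omega>)) \<omega>)) \<omega>) \<and>
        random_homotopic M \<theta> C C (\<lambda>\<omega>. n\<^sub>1 \<omega> + n\<^sub>2 (\<theta> (int (n\<^sub>1 \<omega>)) \<omega>))
          (\<lambda>\<omega> x. s (\<theta> (int (n\<^sub>1 \<omega>)) \<omega>) (r \<omega> x))
          (\<lambda>\<omega>. iter \<theta> c (n\<^sub>1 \<omega> + n\<^sub>2 (\<theta> (int (n\<^sub>1 \<omega>)) \<omega>)) \<omega>))"

section \<open>Filtration pairs and the random Conley index\<close>

definition exit_set ::
  "(int \<Rightarrow> 'w \<Rightarrow> 'w) \<Rightarrow> (int \<Rightarrow> 'w \<Rightarrow> 'x \<Rightarrow> 'x::topological_space) \<Rightarrow> ('w \<Rightarrow> 'x set) \<Rightarrow>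
   'w \<Rightarrow> 'x set" where
  "exit_set \<theta> \<phi> N \<omega> = {x \<in> N \<omega>. \<phi> 1 \<omega> x \<notin> interior (N (\<theta> 1 \<omega>))}"

definition random_filtration_pair ::
  "'w measure \<Rightarrow> (int \<Rightarrow> 'w \<Rightarrow> 'w) \<Rightarrow> (int \<Rightarrow> 'w \<Rightarrow> 'x \<Rightarrow> 'x::state_space) \<Rightarrow>
   ('w \<Rightarrow> 'x set) \<Rightarrow> ('w, 'x) random_pair \<Rightarrow> bool" where
  "random_filtration_pair M \<theta> \<phi> S P \<longleftrightarrow>
     (let N = fst P; L = snd P in
       random_isolating_nbhd M \<theta> \<phi> N \<and>
       regular_random_pair M P \<and>
       random_isolated_invariant M \<theta> \<phi> S \<and> (\<forall>\<omega>\<in>space M. S \<omega> \<subseteq> N \<omega>) \<and>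
       random_isolating_nbhd_of M \<theta> \<phi> S (\<lambda>\<omega>. closure (N \<omega> - L \<omega>)) \<and>
       (\<forall>\<omega>\<in>space M. exit_set \<theta> \<phi> N \<omega> \<subseteq> top_of_set (N \<omega>) interior_of (L \<omega>)) \<and>
       (\<forall>\<omega>\<in>space M. \<phi> 1 \<omega> ` L \<omega> \<inter> closure (N (\<theta> 1 \<omega>) - L (\<theta> 1 \<omega>)) = {}))"

definition pointed_space_map ::
  "(int \<Rightarrow> 'w \<Rightarrow> 'w) \<Rightarrow> (int \<Rightarrow> 'w \<Rightarrow> 'x \<Rightarrow> 'x) \<Rightarrow> ('w, 'x) random_pair \<Rightarrow>
   ('w, 'x, 'x) pointed_map" where
  "pointed_space_map \<theta> \<phi> P \<omega> z =
     (case z of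
        None \<Rightarrow> None
      | Some x \<Rightarrow>
          if \<phi> 1 \<omega> x \<notin> fst P (\<theta> 1 \<omega>) then None
          else quotient_proj (snd P (\<theta> 1 \<omega>)) (\<phi> 1 \<omega> x))"

text \<open>The random shift equivalence class of \<open>(N\<^sub>L, [\<phi>\<^sub>P])\<close> is a proper class, since its members may live
  in any state space; \<open>conley_index\<close> is the set of those members \<open>(C, [c])\<close> whose underlying pair
  \<open>C\<close> lives in the state space \<open>'z\<close>, and equality of indices is equality for every \<open>'z\<close>.
  The quantifier over \<open>P\<close> reflects that the class does not depend on the filtration pair.\<close>

definition conley_index ::
  "'w measure \<Rightarrow> (int \<Rightarrow> 'w \<Rightarrow> 'w) \<Rightarrow> (int \<Rightarrow> 'w \<Rightarrow> 'x \<Rightarrow> 'x::state_space) \<Rightarrow> ('w \<Rightarrow> 'x set) \<Rightarrow>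
   (('w, 'z::state_space) random_pair \<times> ('w, 'z, 'z) pointed_map set) set" where
  "conley_index M \<theta> \<phi> S =
     {(C, homotopy_class M \<theta> C c) | C c.
        \<exists>P. random_filtration_pair M \<theta> \<phi> S P \<and>
            random_shift_equivalent M \<theta> C c P (pointed_space_map \<theta> \<phi> P)}"

end

theory Submission
  imports Defs
begin

text \<open>The homeomorphisms \<open>\<alpha> \<omega>\<close> carry a filtration pair \<open>P\<close> for \<open>S\<close> to a filtration pair \<open>\<alpha> P\<close> for
  \<open>\<alpha> S\<close>, and conjugate \<open>\<phi>\<^sub>P\<close> to the pointed space map of \<open>\<alpha> P\<close>.  A shift equivalence \<open>r\<close>, \<open>s\<close>
  between \<open>(C, c)\<close> and \<open>P\<close> therefore becomes the shift equivalence \<open>\<alpha> \<circ> r\<close>, \<open>s \<circ> \<alpha>\<^sup>-\<^sup>1\<close> between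
  \<open>(C, c)\<close> and \<open>\<alpha> P\<close>, with the same time shifts; the converse inclusion follows with the inverse of
  \<open>\<alpha>\<close>.  The analytic point is measurability: that of \<open>\<omega> \<mapsto> d(x, \<alpha> \<omega> (N \<omega>))\<close>, and that of \<open>s \<circ> \<alpha>\<^sup>-\<^sup>1\<close>
  on quotients whose fibers vary with \<open>\<omega>\<close>.\<close>

text \<open>A random map is measurable in \<omega> only at a fixed argument, and only on the event
  that this argument lies in the fiber. Composition with the inverse homeomorphism on the right
  replaces the fixed argument by the moving point \<open>inv (\<alpha> \<omega>) x\<close>, and the
  target carries only a quotient topology, so the usual composition theorem for Caratheodory
  functions does not apply as it stands. Separability supplies the substitute: the moving point is
  approximated by terms of a dense sequence that lie in the current fiber, with the least suitable
  index, which is a measurable choice. Continuity carries the approximation to the target, where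
  measurability of the limit is proved directly from the quotient topology. Composition with
  \<alpha> on the left is milder, since it fixes the base point and otherwise acts on points of a
  metric space. A second constraint shapes the statements: \<alpha> is a homeomorphism only at
  sample points of \<open>space M\<close>, so many lemmas speak of sets and maps that agree with
  images or conjugates there.\<close>

lemma dense_sequence:
  obtains q :: "nat \<Rightarrow> 'a::second_countable_topology"
  where "\<And>U. open U \<Longrightarrow> U \<noteq> {} \<Longrightarrow> \<exists>i. q i \<in> U"
proof -
  obtain D :: "'a set" where D: "countable D" "\<And>U. open U \<Longrightarrow> U \<noteq> {} \<Longrightarrow> \<exists>d\<in>D. d \<in> U"
    by (rule countable_dense_setE) blast
  then have "D \<noteq> {}"
    using D(2)[of UNIV] by auto
  then have "range (from_nat_into D) = D"
    using D(1) by (simp add: range_from_nat_into)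
  with D(2) have "\<exists>i. from_nat_into D i \<in> U" if "open U" "U \<noteq> {}" for U
    using that by (metis imageE)
  then show thesis
    using that by blast
qed

section \<open>Random compact sets\<close>

text \<open>An infimum lies below r exactly when some element does, so measurability of the distance
  reduces to the events that \<open>N \<omega>\<close> meets a given open ball. Later arguments use
  random compact sets in this form.\<close>

lemma random_compact_iff:
  "random_compact M N \<longleftrightarrow> (\<forall>\<omega>\<in>space M. compact (N \<omega>)) \<and>
     (\<forall>x r. {\<omega> \<in> space M. \<exists>y\<in>N \<omega>. dist x y < r} \<in> sets M)"
proof -
  have "(\<lambda>\<omega>. INF y\<in>N \<omega>. ereal (dist x y)) \<in> borel_measurable M \<longleftrightarrow>
      (\<forall>r. {\<omega> \<in> space M. \<exists>y\<in>N \<omega>. dist x y < r} \<in> sets M)" for x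
  proof
    assume "(\<lambda>\<omega>. INF y\<in>N \<omega>. ereal (dist x y)) \<in> borel_measurable M"
    then have "{\<omega> \<in> space M. (INF y\<in>N \<omega>. ereal (dist x y)) < ereal r} \<in> sets M" for r
      by measurable
    then show "\<forall>r. {\<omega> \<in> space M. \<exists>y\<in>N \<omega>. dist x y < r} \<in> sets M"
      by (simp add: INF_less_iff)
  next
    assume *: "\<forall>r. {\<omega> \<in> space M. \<exists>y\<in>N \<omega>. dist x y < r} \<in> sets M"
    show "(\<lambda>\<omega>. INF y\<in>N \<omega>. ereal (dist x y)) \<in> borel_measurable M"
    proof (rule borel_measurableI_less)
      fix a :: ereal
      show "{\<omega> \<in> space M. (INF y\<in>N \<omega>. ereal (dist x y)) < a} \<in> sets M"
      proof (cases a)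
        case (real r)
        then show ?thesis
          using * by (simp add: INF_less_iff)
      next
        \<comment> \<open>Being below \<infinity> means that the fiber is nonempty; integer radii
          exhaust this event countably.\<close>
        case PInf
        have "{\<omega> \<in> space M. (INF y\<in>N \<omega>. ereal (dist x y)) < a} =
            (\<Union>n::nat. {\<omega> \<in> space M. \<exists>y\<in>N \<omega>. dist x y < real n})"
          unfolding PInf INF_less_iff by auto (metis reals_Archimedean2)
        then show ?thesis
          using * by auto
      qed (simp add: INF_less_iff)
    qed
  qed
  then show ?thesis
    by (auto simp: random_compact_def)
qed

lemma random_compact_nearD:
  "random_compact M N \<Longrightarrow> {\<omega> \<in> space M. \<exists>y\<in>N \<omega>. dist x y < r} \<in> sets M"
  by (simp add: random_compact_iff)

lemma random_compact_compose:
  assumes "random_compact M N" "T \<in> measurable M' M"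
  shows "random_compact M' (\<lambda>\<omega>. N (T \<omega>))"
  unfolding random_compact_iff
proof (intro conjI ballI allI)
  show "compact (N (T \<omega>))" if "\<omega> \<in> space M'" for \<omega>
    using assms that by (auto simp: random_compact_iff dest: measurable_space)
  have "{\<omega> \<in> space M'. \<exists>y\<in>N (T \<omega>). dist x y < r} =
      T -` {\<omega> \<in> space M. \<exists>y\<in>N \<omega>. dist x y < r} \<inter> space M'" for x r
    using measurable_space[OF assms(2)] by auto
  then show "{\<omega> \<in> space M'. \<exists>y\<in>N (T \<omega>). dist x y < r} \<in> sets M'" for x r
    using measurable_sets[OF assms(2) random_compact_nearD[OF assms(1)]] by simp
qed

text \<open>The fiber is closed, so membership means distance zero, which is a countable
  intersection of ball events.\<close>

lemma random_compact_sets_mem: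
  assumes "random_compact M N"
  shows "{\<omega> \<in> space M. x \<in> N \<omega>} \<in> sets M"
proof -
  have "x \<in> N \<omega> \<longleftrightarrow> (\<forall>n. \<exists>y\<in>N \<omega>. dist x y < 1 / Suc n)" if "\<omega> \<in> space M" for \<omega>
  proof
    assume *: "\<forall>n. \<exists>y\<in>N \<omega>. dist x y < 1 / Suc n"
    have "closed (N \<omega>)"
      using assms that by (simp add: random_compact_def compact_imp_closed)
    moreover have "x \<in> closure (N \<omega>)"
      unfolding closure_approachable
    proof (intro allI impI)
      fix e :: real assume "e > 0"
      then obtain n where "1 / Suc n < e"
        by (metis inverse_eq_divide reals_Archimedean)
      then show "\<exists>y\<in>N \<omega>. dist y x < e"
        using *[rule_format, of n] by (metis dist_commute less_trans)
    qed
    ultimately show "x \<in> N \<omega>"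
      by simp
  qed force
  then have "{\<omega> \<in> space M. x \<in> N \<omega>} =
      {\<omega> \<in> space M. \<forall>n. \<omega> \<in> {\<omega> \<in> space M. \<exists>y\<in>N \<omega>. dist x y < 1 / Suc n}}"
    by auto
  also have "\<dots> \<in> sets M"
    using random_compact_nearD[OF assms]
    by (intro sets.sets_Collect_countable_All) (simp add: sets.Int_space_eq1 Collect_conj_eq)
  finally show ?thesis .
qed

text \<open>Compactness turns the existence of a point of \<open>N \<omega>\<close> at which \<open>g \<omega>\<close> is small into the existence
  of such points of a countable dense set arbitrarily close to \<open>N \<omega>\<close>; no measurable selection is
  needed.\<close>

lemma random_compact_sets_ex_less:
  fixes g :: "'w \<Rightarrow> 'x::state_space \<Rightarrow> real"
  assumes N: "random_compact M N"
    and meas: "\<And>x. (\<lambda>\<omega>. g \<omega> x) \<in> borel_measurable M"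
    and cont: "\<And>\<omega>. \<omega> \<in> space M \<Longrightarrow> continuous_on UNIV (g \<omega>)"
  shows "{\<omega> \<in> space M. \<exists>x\<in>N \<omega>. g \<omega> x < r} \<in> sets M"
proof -
  obtain q :: "nat \<Rightarrow> 'x" where q: "\<And>U. open U \<Longrightarrow> U \<noteq> {} \<Longrightarrow> \<exists>i. q i \<in> U"
    by (rule dense_sequence) blast
  \<comment> \<open>The margin \<open>1 / Suc m\<close> is chosen before the accuracy
    \<open>1 / Suc k\<close>. It survives the limit in k as a nonstrict inequality, which still
    leaves a value below r.\<close>
  have "(\<exists>x\<in>N \<omega>. g \<omega> x < r) \<longleftrightarrow>
      (\<exists>m::nat. \<forall>k::nat. \<exists>i. (\<exists>y\<in>N \<omega>. dist (q i) y < 1 / Suc k) \<and> g \<omega> (q i) < r - 1 / Suc m)"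
    (is "?L \<longleftrightarrow> ?R")
    if \<omega>: "\<omega> \<in> space M" for \<omega>
  proof
    assume ?L
    then obtain x where x: "x \<in> N \<omega>" "g \<omega> x < r"
      by blast
    then obtain m :: nat where "1 / Suc m < r - g \<omega> x"
      by (metis diff_gt_0_iff_gt inverse_eq_divide reals_Archimedean)
    then have m: "g \<omega> x < r - 1 / Suc m"
      by simp
    have "\<exists>i. (\<exists>y\<in>N \<omega>. dist (q i) y < 1 / Suc k) \<and> g \<omega> (q i) < r - 1 / Suc m" for k :: nat
    proof -
      let ?U = "{z. g \<omega> z < r - 1 / Suc m} \<inter> ball x (1 / Suc k)"
      have "open ?U"
        by (intro open_Int open_Collect_less cont[OF \<omega>] continuous_intros open_ball)
      moreover have "x \<in> ?U"
        using m by simp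
      ultimately obtain i where "q i \<in> ?U"
        using q[of ?U] by blast
      then show ?thesis
        using x(1) by (auto simp: dist_commute)
    qed
    then show ?R
      by blast
  next
    assume ?R
    then obtain m :: nat where
      "\<forall>k. \<exists>i y. y \<in> N \<omega> \<and> dist (q i) y < 1 / Suc k \<and> g \<omega> (q i) < r - 1 / Suc m"
      by blast
    then obtain i y where iy: "\<And>k. y k \<in> N \<omega>" "\<And>k. dist (q (i k)) (y k) < 1 / Suc k"
      "\<And>k. g \<omega> (q (i k)) < r - 1 / Suc m"
      by metis
    have "compact (N \<omega>)"
      using N \<omega> by (simp add: random_compact_def)
    \<comment> \<open>A subsequence of \<open>y k\<close> converges inside the fiber and draws the
      nearby points \<open>q (i k)\<close> to the same limit.\<close>
    then obtain l \<rho> where l: "l \<in> N \<omega>" "strict_mono (\<rho> :: nat \<Rightarrow> nat)" "(y \<circ> \<rho>) \<longlonglongrightarrow> l"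
      using iy(1) unfolding compact_def by blast
    from l(3) have y: "(\<lambda>k. dist (y (\<rho> k)) l) \<longlonglongrightarrow> 0"
      by (simp add: o_def tendsto_dist_iff[of _ l])
    have "norm (dist (q (i k)) (y k)) \<le> inverse (real (Suc k))" for k
      using iy(2)[of k] by (simp add: inverse_eq_divide)
    then have "(\<lambda>k. dist (q (i k)) (y k)) \<longlonglongrightarrow> 0"
      by (intro Lim_null_comparison[OF always_eventually LIMSEQ_inverse_real_of_nat] allI)
    from LIMSEQ_subseq_LIMSEQ[OF this l(2)]
    have "(\<lambda>k. dist (q (i (\<rho> k))) (y (\<rho> k)) + dist (y (\<rho> k)) l) \<longlonglongrightarrow> 0"
      unfolding o_def by (rule tendsto_add_zero[OF _ y])
    then have "(\<lambda>k. q (i (\<rho> k))) \<longlonglongrightarrow> l"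
      unfolding tendsto_dist_iff[of _ l]
      by (rule Lim_null_comparison[OF always_eventually, rotated]) (simp add: dist_triangle)
    then have "(\<lambda>k. g \<omega> (q (i (\<rho> k)))) \<longlonglongrightarrow> g \<omega> l"
      by (intro continuous_on_tendsto_compose[OF cont[OF \<omega>]]) simp_all
    then have "g \<omega> l \<le> r - 1 / Suc m"
      by (rule LIMSEQ_le_const2) (use iy(3) in \<open>simp add: less_imp_le\<close>)
    also have "\<dots> < r"
      by simp
    finally show ?L
      using l(1) by blast
  qed
  then have "{\<omega> \<in> space M. \<exists>x\<in>N \<omega>. g \<omega> x < r} = {\<omega> \<in> space M. \<exists>m::nat. \<forall>k::nat. \<exists>i.
      \<omega> \<in> {\<omega> \<in> space M. \<exists>y\<in>N \<omega>. dist (q i) y < 1 / Suc k} \<and> g \<omega> (q i) < r - 1 / Suc m}"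
    by (simp cong: conj_cong)
  also have "\<dots> \<in> sets M"
  proof -
    have [measurable]: "{\<omega> \<in> space M. \<exists>y\<in>N \<omega>. dist (q i) y < 1 / Suc k} \<in> sets M" for i k
      by (rule random_compact_nearD[OF N])
    note meas[measurable]
    show ?thesis
      by measurable
  qed
  finally show ?thesis .
qed

section \<open>Measurability in pointed spaces\<close>

lemma space_pointed_borel [simp]: "space pointed_borel = UNIV"
  by (simp add: pointed_borel_def space_measure_of_conv)

text \<open>Replacing the base point by a default \<open>c\<close> reduces the question to Borel
  measurability in the state space. As \<open>c\<close> may also occur as a genuine value, the event
  of the base point is recorded separately.\<close>

lemma measurable_pointed_borel_iff:
  fixes f :: "'w \<Rightarrow> 'x::topological_space option"
  shows "f \<in> measurable M pointed_borel \<longleftrightarrow>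
     {\<omega> \<in> space M. f \<omega> = None} \<in> sets M \<and> (\<lambda>\<omega>. case_option c id (f \<omega>)) \<in> borel_measurable M"
  (is "?L \<longleftrightarrow> ?N \<and> ?V")
proof
  have sets: "{None} \<in> sets pointed_borel" "A \<in> sets borel \<Longrightarrow> Some ` A \<in> sets pointed_borel" for A
    unfolding pointed_borel_def by (auto intro: sigma_sets.Basic)
  assume f: ?L
  have "f -` {None} \<inter> space M = {\<omega> \<in> space M. f \<omega> = None}"
    by auto
  then have N: ?N
    using measurable_sets[OF f sets(1)] by simp
  have "case_option c id \<in> measurable pointed_borel borel"
  proof (rule measurableI)
    fix A :: "'x set" assume A: "A \<in> sets borel"
    have "case_option c id -` A \<inter> space pointed_borel =
        Some ` A \<union> (if c \<in> A then {None} else {})"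
      by (auto split: option.splits if_splits)
    then show "case_option c id -` A \<inter> space pointed_borel \<in> sets pointed_borel"
      using sets(2)[OF A] sets.Un[OF sets(2)[OF A] sets(1)] by auto
  qed simp
  then show "?N \<and> ?V"
    using N measurable_compose[OF f] by blast
next
  assume *: "?N \<and> ?V"
  show ?L
    unfolding pointed_borel_def
  proof (rule measurable_measure_of)
    fix A :: "'x option set" assume "A \<in> insert {None} ((`) Some ` sets borel)"
    then consider "A = {None}" | B where "B \<in> sets borel" "A = Some ` B"
      by auto
    then show "f -` A \<inter> space M \<in> sets M"
    proof cases
      case 1
      then have "f -` A \<inter> space M = {\<omega> \<in> space M. f \<omega> = None}"
        by auto
      then show ?thesis
        using * by simp
    next
      case 2
      then have "f -` A \<inter> space M =
          ((\<lambda>\<omega>. case_option c id (f \<omega>)) -` B \<inter> space M) - {\<omega> \<in> space M. f \<omega> = None}"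
        by (auto split: option.splits simp: image_iff)
      then show ?thesis
        using * measurable_sets 2(1) by auto
    qed
  qed auto
qed

text \<open>Convergence in the quotient is tested against the neighbourhoods of the base point obtained
  from the neighbourhoods of \<open>L \<omega>\<close>; these depend measurably on \<open>\<omega>\<close>.\<close>

lemma measurable_limitin_pointed_quotient:
  fixes h :: "'w \<Rightarrow> 'x::state_space option"
  assumes L: "random_compact M L"
    and meas: "\<And>k. (\<lambda>\<omega>. f k \<omega>) \<in> measurable M pointed_borel"
    and lim: "\<And>\<omega>. \<omega> \<in> space M \<Longrightarrow> limitin (pointed_quotient (N \<omega>) (L \<omega>)) (\<lambda>k. f k \<omega>) (h \<omega>) sequentially"
  shows "h \<in> measurable M pointed_borel"
proof -
  obtain q :: "nat \<Rightarrow> 'x" where q: "\<And>U. open U \<Longrightarrow> U \<noteq> {} \<Longrightarrow> \<exists>i. q i \<in> U"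
    by (rule dense_sequence) blast
  define c :: 'x where "c = undefined"
  define v :: "'x option \<Rightarrow> 'x" where "v = case_option c id"
  have v_Some [simp]: "v (Some x) = x" for x
    by (simp add: v_def)
  have [measurable]: "(\<lambda>\<omega>. v (f k \<omega>)) \<in> borel_measurable M" "{\<omega> \<in> space M. f k \<omega> = None} \<in> sets M" for k
    using meas[of k] unfolding v_def measurable_pointed_borel_iff[of "f k" M c] by blast+
  have closed: "closed (L \<omega>)" if "\<omega> \<in> space M" for \<omega>
    using L that by (simp add: random_compact_def compact_imp_closed)
  have lim_None: "\<forall>\<^sub>F k in sequentially. f k \<omega> = None \<or> v (f k \<omega>) \<in> W"
    if \<omega>: "\<omega> \<in> space M" and "h \<omega> = None" and W: "open W" "L \<omega> \<subseteq> W" for \<omega> W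
  proof -
    \<comment> \<open>Because W contains the whole of \<open>L \<omega>\<close>, the preimage of
      this set is \<open>N \<omega> \<inter> W\<close>, hence relatively open.\<close>
    let ?U = "insert None (Some ` (W \<inter> N \<omega> - L \<omega>))"
    have "{x \<in> N \<omega>. quotient_proj (L \<omega>) x \<in> ?U} = N \<omega> \<inter> W"
      using W(2) by (auto simp: quotient_proj_def)
    then have "openin (pointed_quotient (N \<omega>) (L \<omega>)) ?U"
      unfolding openin_pointed_quotient using openin_open_Int[OF W(1)] by auto
    then have "\<forall>\<^sub>F k in sequentially. f k \<omega> \<in> ?U"
      using lim[OF \<omega>] \<open>h \<omega> = None\<close> unfolding limitin_def by blast
    then show ?thesis
      by (rule eventually_mono) auto
  qed
  have lim_Some: "\<forall>\<^sub>F k in sequentially. f k \<omega> \<noteq> None \<and> v (f k \<omega>) \<in> W"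
    if \<omega>: "\<omega> \<in> space M" and h: "h \<omega> = Some x" and W: "open W" "x \<in> W" for \<omega> W x
  proof -
    let ?U = "Some ` (W \<inter> N \<omega> - L \<omega>)"
    have "{x \<in> N \<omega>. quotient_proj (L \<omega>) x \<in> ?U} = N \<omega> \<inter> (W - L \<omega>)"
      by (auto simp: quotient_proj_def)
    then have "openin (pointed_quotient (N \<omega>) (L \<omega>)) ?U"
      unfolding openin_pointed_quotient
      using openin_open_Int[OF open_Diff[OF W(1) closed[OF \<omega>]]] by auto
    moreover have "h \<omega> \<in> ?U"
      using limitin_topspace[OF lim[OF \<omega>]] h W(2) by (auto simp: topspace_pointed_quotient)
    ultimately have "\<forall>\<^sub>F k in sequentially. f k \<omega> \<in> ?U"
      using lim[OF \<omega>] unfolding limitin_def by blast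
    then show ?thesis
      by (rule eventually_mono) auto
  qed
  \<comment> \<open>The ball events for L are available at fixed centers, while the center
    \<open>v (f k \<omega>)\<close> moves with \<omega>. Passing through a nearby \<open>q i\<close>
    leaves countably many fixed centers. Two errors of \<open>1 / Suc n\<close> must fit below
    \<open>r - dist x y\<close>, hence the halving.\<close>
  have near: "(\<exists>y\<in>L \<omega>. dist x y < r) \<longleftrightarrow> (\<exists>i n. dist x (q i) < 1 / Suc n \<and> (\<exists>y\<in>L \<omega>. dist (q i) y < r - 1 / Suc n))"
    for x r \<omega>
  proof
    assume "\<exists>y\<in>L \<omega>. dist x y < r"
    then obtain y where y: "y \<in> L \<omega>" "dist x y < r"
      by blast
    then obtain n :: nat where n: "1 / Suc n < (r - dist x y) / 2"
      using reals_Archimedean[of "(r - dist x y) / 2"] by (auto simp: inverse_eq_divide)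
    obtain i where i: "q i \<in> ball x (1 / Suc n)"
      using q[of "ball x (1 / Suc n)"] by auto
    have "dist (q i) y \<le> dist x (q i) + dist x y"
      by (metis dist_commute dist_triangle)
    moreover have "2 * (1 / Suc n) + dist x y < r" "dist x (q i) < 1 / Suc n"
      using n i by auto
    ultimately have "dist (q i) y < r - 1 / Suc n"
      by linarith
    then show "\<exists>i n. dist x (q i) < 1 / Suc n \<and> (\<exists>y\<in>L \<omega>. dist (q i) y < r - 1 / Suc n)"
      using y(1) i by auto
  next
    assume "\<exists>i n. dist x (q i) < 1 / Suc n \<and> (\<exists>y\<in>L \<omega>. dist (q i) y < r - 1 / Suc n)"
    then obtain i n y where "dist x (q i) < 1 / Suc n" "y \<in> L \<omega>" "dist (q i) y < r - 1 / Suc n"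
      by blast
    then show "\<exists>y\<in>L \<omega>. dist x y < r"
      using dist_triangle[of x y "q i"] by (intro bexI[of _ y]) auto
  qed
  \<comment> \<open>Uniform neighbourhoods of L recognise the base point: a limit
    \<open>Some x\<close> has a ball of some radius e around x that misses the closed set L, and
    terms within e/2 of x cannot be within \<open>1 / Suc m\<close> < e/2 of L.\<close>
  have "h \<omega> = None \<longleftrightarrow>
      (\<forall>m::nat. \<forall>\<^sub>F k in sequentially. f k \<omega> = None \<or> (\<exists>y\<in>L \<omega>. dist (v (f k \<omega>)) y < 1 / Suc m))"
    if \<omega>: "\<omega> \<in> space M" for \<omega>
  proof
    assume h: "h \<omega> = None"
    show "\<forall>m::nat. \<forall>\<^sub>F k in sequentially. f k \<omega> = None \<or> (\<exists>y\<in>L \<omega>. dist (v (f k \<omega>)) y < 1 / Suc m)"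
    proof
      fix m :: nat
      let ?W = "\<Union>y\<in>L \<omega>. ball y (1 / Suc m)"
      have "L \<omega> \<subseteq> ?W"
        by force
      then have "\<forall>\<^sub>F k in sequentially. f k \<omega> = None \<or> v (f k \<omega>) \<in> ?W"
        by (intro lim_None[OF \<omega> h] open_UN ballI open_ball)
      then show "\<forall>\<^sub>F k in sequentially. f k \<omega> = None \<or> (\<exists>y\<in>L \<omega>. dist (v (f k \<omega>)) y < 1 / Suc m)"
        by (rule eventually_mono) (auto simp: dist_commute)
    qed
  next
    assume *: "\<forall>m::nat. \<forall>\<^sub>F k in sequentially. f k \<omega> = None \<or> (\<exists>y\<in>L \<omega>. dist (v (f k \<omega>)) y < 1 / Suc m)"
    show "h \<omega> = None"
    proof (rule ccontr)
      assume "h \<omega> \<noteq> None"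
      then obtain x where h: "h \<omega> = Some x"
        by blast
      then have "x \<in> - L \<omega>"
        using limitin_topspace[OF lim[OF \<omega>]] by (auto simp: topspace_pointed_quotient)
      then obtain e where e: "e > 0" "ball x e \<subseteq> - L \<omega>"
        using closed[OF \<omega>] by (meson open_Compl open_contains_ball)
      then obtain m :: nat where m: "1 / Suc m < e / 2"
        by (metis half_gt_zero inverse_eq_divide reals_Archimedean)
      have "\<forall>\<^sub>F k in sequentially. f k \<omega> \<noteq> None \<and> v (f k \<omega>) \<in> ball x (e / 2)"
        using e(1) by (intro lim_Some[OF \<omega> h]) auto
      with *[rule_format, of m] have "\<forall>\<^sub>F k in sequentially. False"
      proof (rule eventually_elim2)
        fix k
        assume "f k \<omega> = None \<or> (\<exists>y\<in>L \<omega>. dist (v (f k \<omega>)) y < 1 / Suc m)"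
          and "f k \<omega> \<noteq> None \<and> v (f k \<omega>) \<in> ball x (e / 2)"
        then obtain y where y: "y \<in> L \<omega>" "dist (v (f k \<omega>)) y < 1 / Suc m" "dist x (v (f k \<omega>)) < e / 2"
          by auto
        then have "dist x y < e"
          using m dist_triangle[of x y "v (f k \<omega>)"] by linarith
        then show False
          using e(2) y(1) by auto
      qed
      then show False
        by simp
    qed
  qed
  then have "{\<omega> \<in> space M. h \<omega> = None} = {\<omega> \<in> space M. \<forall>m::nat. \<exists>K. \<forall>k\<ge>K.
      \<omega> \<in> {\<omega> \<in> space M. f k \<omega> = None} \<or> \<omega> \<in> {\<omega> \<in> space M. \<exists>y\<in>L \<omega>. dist (v (f k \<omega>)) y < 1 / Suc m}}"
    by (auto simp: eventually_sequentially)
  also have "\<dots> \<in> sets M"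
  proof -
    have [measurable]: "{\<omega> \<in> space M. \<exists>y\<in>L \<omega>. dist (q i) y < r} \<in> sets M" for i r
      by (rule random_compact_nearD[OF L])
    have [measurable]: "{\<omega> \<in> space M. \<exists>y\<in>L \<omega>. dist (v (f k \<omega>)) y < r} \<in> sets M" for k r
    proof -
      have "{\<omega> \<in> space M. \<exists>y\<in>L \<omega>. dist (v (f k \<omega>)) y < r} =
          {\<omega> \<in> space M. \<exists>i n. dist (v (f k \<omega>)) (q i) < 1 / Suc n \<and> (\<exists>y\<in>L \<omega>. dist (q i) y < r - 1 / Suc n)}"
        by (intro Collect_cong conj_cong refl near)
      also have "\<dots> = {\<omega> \<in> space M. \<exists>i n. dist (v (f k \<omega>)) (q i) < 1 / Suc n \<and>
          \<omega> \<in> {\<omega> \<in> space M. \<exists>y\<in>L \<omega>. dist (q i) y < r - 1 / Suc n}}"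
        by auto
      also have "\<dots> \<in> sets M"
        by measurable
      finally show ?thesis .
    qed
    show ?thesis
      by measurable
  qed
  finally have N [measurable]: "{\<omega> \<in> space M. h \<omega> = None} \<in> sets M" .
  have "(\<lambda>\<omega>. v (h \<omega>)) \<in> borel_measurable M"
  proof (rule borel_measurable_LIMSEQ_metric)
    \<comment> \<open>Where the limit is the base point, the values \<open>v (f k \<omega>)\<close>
      may wander along L without converging; there they are replaced by the constant
      \<open>c\<close>, which is also the value of \<open>v\<close> at the limit.\<close>
    show "(\<lambda>\<omega>. if \<omega> \<in> {\<omega> \<in> space M. h \<omega> = None} then c else v (f k \<omega>)) \<in> borel_measurable M" for k
      by measurable
    show "(\<lambda>k. if \<omega> \<in> {\<omega> \<in> space M. h \<omega> = None} then c else v (f k \<omega>)) \<longlonglongrightarrow> v (h \<omega>)"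
      if \<omega>: "\<omega> \<in> space M" for \<omega>
    proof (cases "h \<omega>")
      case None
      then show ?thesis
        using \<omega> by (simp add: v_def)
    next
      case (Some x)
      have "(\<lambda>k. v (f k \<omega>)) \<longlonglongrightarrow> x"
        by (rule topological_tendstoI) (rule eventually_mono[OF lim_Some[OF \<omega> Some]], auto)
      then show ?thesis
        using Some by simp
    qed
  qed
  with N show ?thesis
    using measurable_pointed_borel_iff[of h M c] by (simp add: v_def)
qed

section \<open>Composition of Caratheodory functions\<close>

text \<open>The least index is measurable because the condition defining it is measurable for each
  i. The event \<open>E i\<close> says when \<open>q i\<close> is admissible; for quotients it keeps
  the approximants inside the moving fiber.\<close>

lemma measurable_approximation:
  fixes q :: "nat \<Rightarrow> 'x::{metric_space, second_countable_topology}"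
  assumes z: "z \<in> borel_measurable M"
    and E: "\<And>i. E i \<in> sets M"
    and dense: "\<And>\<omega> e. \<omega> \<in> space M \<Longrightarrow> e > 0 \<Longrightarrow> \<exists>i. dist (q i) (z \<omega>) < e \<and> \<omega> \<in> E i"
  shows "\<exists>J. (\<forall>k. J k \<in> measurable M (count_space UNIV)) \<and>
    (\<forall>\<omega>\<in>space M. (\<forall>k. \<omega> \<in> E (J k \<omega>)) \<and> (\<lambda>k. q (J k \<omega>)) \<longlonglongrightarrow> z \<omega>)"
proof -
  define J :: "nat \<Rightarrow> 'a \<Rightarrow> nat" where "J = (\<lambda>k \<omega>. LEAST i. dist (q i) (z \<omega>) < 1 / Suc k \<and> \<omega> \<in> E i)"
  note z [measurable] E [measurable]
  have Jm: "J k \<in> measurable M (count_space UNIV)" for k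
    unfolding J_def by measurable
  have J: "dist (q (J k \<omega>)) (z \<omega>) < 1 / Suc k \<and> \<omega> \<in> E (J k \<omega>)" if "\<omega> \<in> space M" for k \<omega>
    unfolding J_def by (rule LeastI_ex) (use dense[OF that] in simp)
  moreover have "(\<lambda>k. q (J k \<omega>)) \<longlonglongrightarrow> z \<omega>" if "\<omega> \<in> space M" for \<omega>
  proof -
    have "norm (dist (q (J k \<omega>)) (z \<omega>)) \<le> inverse (real (Suc k))" for k
      using J[OF that, of k] by (simp add: inverse_eq_divide)
    then show ?thesis
      unfolding tendsto_dist_iff[of _ "z \<omega>"]
      by (intro Lim_null_comparison[OF always_eventually LIMSEQ_inverse_real_of_nat] allI)
  qed
  ultimately show ?thesis
    using Jm by blast
qed

text \<open>The approximants of \<open>z\<close> take countably many values, so \<open>g\<close> is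
  measurable along them; continuity passes this to the limit.\<close>

lemma borel_measurable_caratheodory_compose:
  fixes g :: "'w \<Rightarrow> 'x::{metric_space, second_countable_topology} \<Rightarrow> 'y::metric_space"
  assumes meas: "\<And>x. (\<lambda>\<omega>. g \<omega> x) \<in> borel_measurable M"
    and cont: "\<And>\<omega>. \<omega> \<in> space M \<Longrightarrow> continuous_on UNIV (g \<omega>)"
    and z: "z \<in> borel_measurable M"
  shows "(\<lambda>\<omega>. g \<omega> (z \<omega>)) \<in> borel_measurable M"
proof -
  obtain q :: "nat \<Rightarrow> 'x" where q: "\<And>U. open U \<Longrightarrow> U \<noteq> {} \<Longrightarrow> \<exists>i. q i \<in> U"
    by (rule dense_sequence) blast
  have dense: "\<exists>i. dist (q i) (z \<omega>) < e \<and> \<omega> \<in> space M" if "\<omega> \<in> space M" "e > 0" for \<omega> e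
    using q[of "ball (z \<omega>) e"] that by (simp add: dist_commute)
  obtain J where J: "\<And>k. J k \<in> measurable M (count_space UNIV)"
    "\<And>\<omega>. \<omega> \<in> space M \<Longrightarrow> (\<lambda>k. q (J k \<omega>)) \<longlonglongrightarrow> z \<omega>"
    using measurable_approximation[OF z sets.top dense] by blast
  show ?thesis
  proof (rule borel_measurable_LIMSEQ_metric)
    show "(\<lambda>\<omega>. g \<omega> (q (J k \<omega>))) \<in> borel_measurable M" for k
      by (rule measurable_compose_countable[OF meas J(1)])
    show "(\<lambda>k. g \<omega> (q (J k \<omega>))) \<longlonglongrightarrow> g \<omega> (z \<omega>)" if "\<omega> \<in> space M" for \<omega>
      by (rule continuous_on_tendsto_compose[OF cont J(2)]) (use that in simp_all)
  qed
qed

text \<open>On \<open>N - L\<close> an open set of the quotient is the trace of an open set of the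
  state space, so metric convergence is enough there.\<close>

lemma limitin_pointed_quotient_Some:
  assumes "\<And>k. x k \<in> N - L" "y \<in> N - L" "x \<longlonglongrightarrow> y"
  shows "limitin (pointed_quotient N L) (\<lambda>k. Some (x k)) (Some y) sequentially"
  unfolding limitin_def
proof (intro conjI allI impI)
  show "Some y \<in> topspace (pointed_quotient N L)"
    using assms(2) by (simp add: topspace_pointed_quotient)
  fix U assume U: "openin (pointed_quotient N L) U \<and> Some y \<in> U"
  then obtain V where V: "open V" "{x \<in> N. quotient_proj L x \<in> U} = N \<inter> V"
    unfolding openin_pointed_quotient openin_open by blast
  have *: "Some x \<in> U \<longleftrightarrow> x \<in> V" if "x \<in> N - L" for x
    using that eqset_imp_iff[OF V(2), of x] by (simp add: quotient_proj_def)
  have "\<forall>\<^sub>F k in sequentially. x k \<in> V"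
    using *[OF assms(2)] U V(1) by (intro topological_tendstoD[OF assms(3)]) blast+
  then show "\<forall>\<^sub>F k in sequentially. Some (x k) \<in> U"
    by (rule eventually_mono) (use *[OF assms(1)] in blast)
qed

text \<open>Since \<open>N = cl (int N)\<close>, each point of \<open>N - L\<close> is a limit of points of \<open>N - L\<close> from a countable
  dense set, at which \<open>f\<close> is measurable by hypothesis.\<close>

lemma measurable_fiber_compose:
  fixes D :: "('w, 'x::state_space) random_pair" and C :: "('w, 'y::state_space) random_pair"
  assumes D: "regular_random_pair M D" and C: "regular_random_pair M C"
    and T: "T \<in> measurable M M"
    and cont: "\<And>\<omega>. \<omega> \<in> space M \<Longrightarrow> continuous_map (fiber D \<omega>) (fiber C (T \<omega>)) (f \<omega>)"
    and meas: "\<And>x. (\<lambda>\<omega>. f \<omega> x) \<in>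
      measurable (restrict_space M {\<omega> \<in> space M. x \<in> topspace (fiber D \<omega>)}) pointed_borel"
    and F: "F \<in> sets M" and z: "z \<in> borel_measurable (restrict_space M F)"
    and zD: "\<And>\<omega>. \<omega> \<in> F \<Longrightarrow> z \<omega> \<in> fst D \<omega> - snd D \<omega>"
  shows "(\<lambda>\<omega>. f \<omega> (Some (z \<omega>))) \<in> measurable (restrict_space M F) pointed_borel"
proof -
  let ?M = "restrict_space M F"
  have space: "space ?M = F"
    using F by (simp add: space_restrict_space2)
  have F_space: "\<omega> \<in> space M" if "\<omega> \<in> F" for \<omega>
    using F that sets.sets_into_space by auto
  obtain q :: "nat \<Rightarrow> 'x" where q: "\<And>U. open U \<Longrightarrow> U \<noteq> {} \<Longrightarrow> \<exists>i. q i \<in> U"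
    by (rule dense_sequence) blast
  define E where "E i = {\<omega> \<in> space M. q i \<in> fst D \<omega> - snd D \<omega>}" for i
  have E: "E i \<in> sets M" for i
  proof -
    have "E i = {\<omega> \<in> space M. q i \<in> fst D \<omega>} - {\<omega> \<in> space M. q i \<in> snd D \<omega>}"
      by (auto simp: E_def)
    then show ?thesis
      using D by (auto simp: regular_random_pair_def intro!: sets.Diff random_compact_sets_mem)
  qed
  \<comment> \<open>The default \<open>None\<close> extends the map from \<open>E i\<close> to the
    whole sample space. The indices chosen below satisfy
    \<open>\<omega> \<in> E (J k \<omega>)\<close>, so the default never enters the limit.\<close>
  define h where "h i \<omega> = (if \<omega> \<in> E i then f \<omega> (Some (q i)) else None)" for i \<omega>
  have "E i = {\<omega> \<in> space M. Some (q i) \<in> topspace (fiber D \<omega>)}" for i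
    by (auto simp: E_def fiber_def topspace_pointed_quotient)
  then have "h i \<in> measurable M pointed_borel" for i
    using meas[of "Some (q i)"] E[of i] sets.sets_into_space[OF E, of i] unfolding h_def
    by (subst measurable_restrict_space_iff[symmetric]) (simp_all add: Int_absorb2)
  then have h: "h i \<in> measurable ?M pointed_borel" for i
    by (rule measurable_restrict_space1)
  have dense: "\<exists>i. dist (q i) (z \<omega>) < e \<and> \<omega> \<in> E i \<inter> F" if \<omega>: "\<omega> \<in> space ?M" and "e > 0" for \<omega> e
  proof -
    have "\<omega> \<in> F" "\<omega> \<in> space M"
      using \<omega> F_space space by simp_all
    then have N: "fst D \<omega> = closure (interior (fst D \<omega>))" and "compact (snd D \<omega>)"
      using D by (simp_all add: regular_random_pair_def random_compact_def)
    then have closed: "closed (snd D \<omega>)"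
      by (simp add: compact_imp_closed)
    \<comment> \<open>This open set meets the closure of the interior of the fiber set, hence the
      interior itself. The intersection is open and nonempty, so it contains a term of the dense
      sequence, automatically off L.\<close>
    let ?U = "ball (z \<omega>) e \<inter> - snd D \<omega>"
    have "open ?U"
      using closed by (intro open_Int open_ball open_Compl)
    moreover have "z \<omega> \<in> ?U \<inter> closure (interior (fst D \<omega>))"
      using zD[OF \<open>\<omega> \<in> F\<close>] \<open>e > 0\<close> unfolding N[symmetric] by simp
    ultimately have "?U \<inter> interior (fst D \<omega>) \<noteq> {}"
      using open_Int_closure_eq_empty by blast
    then obtain i where i: "q i \<in> ?U \<inter> interior (fst D \<omega>)"
      using q[of "?U \<inter> interior (fst D \<omega>)"] open_Int[OF \<open>open ?U\<close> open_interior] by blast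
    moreover from i have "q i \<in> fst D \<omega>"
      using interior_subset by blast
    ultimately have "dist (q i) (z \<omega>) < e \<and> \<omega> \<in> E i \<inter> F"
      using \<open>\<omega> \<in> F\<close> \<open>\<omega> \<in> space M\<close> by (simp add: E_def dist_commute)
    then show ?thesis
      by blast
  qed
  have EF: "E i \<inter> F \<in> sets ?M" for i
    using E[of i] by (simp add: sets_restrict_space Int_commute)
  obtain J where J: "\<And>k. J k \<in> measurable ?M (count_space UNIV)"
    "\<And>k \<omega>. \<omega> \<in> space ?M \<Longrightarrow> \<omega> \<in> E (J k \<omega>) \<inter> F"
    "\<And>\<omega>. \<omega> \<in> space ?M \<Longrightarrow> (\<lambda>k. q (J k \<omega>)) \<longlonglongrightarrow> z \<omega>"
    using measurable_approximation[OF z EF dense] by blast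
  show ?thesis
  proof (rule measurable_limitin_pointed_quotient)
    show "random_compact ?M (\<lambda>\<omega>. snd C (T \<omega>))"
      using C T unfolding regular_random_pair_def
      by (blast intro: random_compact_compose measurable_restrict_space1)
    show "(\<lambda>\<omega>. h (J k \<omega>) \<omega>) \<in> measurable ?M pointed_borel" for k
      by (rule measurable_compose_countable[OF h J(1)])
    fix \<omega> assume \<omega>: "\<omega> \<in> space ?M"
    have "limitin (fiber D \<omega>) (\<lambda>k. Some (q (J k \<omega>))) (Some (z \<omega>)) sequentially"
      unfolding fiber_def
    proof (rule limitin_pointed_quotient_Some[OF _ _ J(3)[OF \<omega>]])
      show "q (J k \<omega>) \<in> fst D \<omega> - snd D \<omega>" for k
        using J(2)[OF \<omega>, of k] by (simp add: E_def)
      show "z \<omega> \<in> fst D \<omega> - snd D \<omega>"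
        using zD[of \<omega>] \<omega> space by simp
    qed
    then have "limitin (fiber C (T \<omega>)) (f \<omega> \<circ> (\<lambda>k. Some (q (J k \<omega>)))) (f \<omega> (Some (z \<omega>))) sequentially"
      using cont[of \<omega>] F_space \<omega> space by (intro continuous_map_limit) simp_all
    moreover have "f \<omega> \<circ> (\<lambda>k. Some (q (J k \<omega>))) = (\<lambda>k. h (J k \<omega>) \<omega>)"
      using J(2)[OF \<omega>] by (simp add: h_def o_def)
    ultimately show "limitin (pointed_quotient (fst C (T \<omega>)) (snd C (T \<omega>))) (\<lambda>k. h (J k \<omega>) \<omega>)
        (f \<omega> (Some (z \<omega>))) sequentially"
      by (simp add: fiber_def)
  qed
qed

section \<open>Random homeomorphisms\<close>

text \<open>The part of a topological equivalence that does not mention the two systems; it suffices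
  for all transport of sets, quotients and random maps.\<close>

definition random_homeomorphism ::
  "'w measure \<Rightarrow> ('w \<Rightarrow> 'x::state_space \<Rightarrow> 'y::state_space) \<Rightarrow> bool" where
  "random_homeomorphism M \<alpha> \<longleftrightarrow>
     (\<forall>\<omega>\<in>space M. homeomorphism UNIV UNIV (\<alpha> \<omega>) (inv (\<alpha> \<omega>))) \<and>
     (\<forall>x. (\<lambda>\<omega>. \<alpha> \<omega> x) \<in> borel_measurable M) \<and>
     (\<forall>y. (\<lambda>\<omega>. inv (\<alpha> \<omega>) y) \<in> borel_measurable M)"

lemma random_homeomorphism_bij:
  "random_homeomorphism M \<alpha> \<Longrightarrow> \<omega> \<in> space M \<Longrightarrow> bij (\<alpha> \<omega>)"
  by (rule o_bij[where g = "inv (\<alpha> \<omega>)"])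
    (auto simp: random_homeomorphism_def homeomorphism_def)

lemma random_homeomorphism_continuous:
  "random_homeomorphism M \<alpha> \<Longrightarrow> \<omega> \<in> space M \<Longrightarrow> continuous_on UNIV (\<alpha> \<omega>)"
  "random_homeomorphism M \<alpha> \<Longrightarrow> \<omega> \<in> space M \<Longrightarrow> continuous_on UNIV (inv (\<alpha> \<omega>))"
  unfolding random_homeomorphism_def homeomorphism_def by blast+

lemma random_homeomorphism_homeomorphic_map:
  "random_homeomorphism M \<alpha> \<Longrightarrow> \<omega> \<in> space M \<Longrightarrow> homeomorphic_map euclidean euclidean (\<alpha> \<omega>)"
  unfolding random_homeomorphism_def homeomorphism_def homeomorphic_map_maps homeomorphic_maps_def
  by auto

lemma random_homeomorphism_inv:
  assumes "random_homeomorphism M \<alpha>"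
  shows "random_homeomorphism M (\<lambda>\<omega>. inv (\<alpha> \<omega>))"
proof -
  have inv: "inv (inv (\<alpha> \<omega>)) = \<alpha> \<omega>" if "\<omega> \<in> space M" for \<omega>
    using random_homeomorphism_bij[OF assms that] by (rule inv_inv_eq)
  have "(\<lambda>\<omega>. \<alpha> \<omega> x) \<in> borel_measurable M" for x
    using assms by (simp add: random_homeomorphism_def)
  then have "(\<lambda>\<omega>. inv (inv (\<alpha> \<omega>)) x) \<in> borel_measurable M" for x
    by (subst measurable_cong[of M _ "\<lambda>\<omega>. \<alpha> \<omega> x" for x]) (auto simp: inv)
  moreover have "homeomorphism UNIV UNIV (inv (\<alpha> \<omega>)) (inv (inv (\<alpha> \<omega>)))" if "\<omega> \<in> space M" for \<omega>
    unfolding inv[OF that]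
    by (rule homeomorphism_symD) (use assms that in \<open>simp add: random_homeomorphism_def\<close>)
  ultimately show ?thesis
    using assms by (simp add: random_homeomorphism_def)
qed

lemma random_homeomorphism_measurable_compose:
  assumes "random_homeomorphism M \<alpha>" "T \<in> measurable M' M" "z \<in> borel_measurable M'"
  shows "(\<lambda>\<omega>. \<alpha> (T \<omega>) (z \<omega>)) \<in> borel_measurable M'"
proof (rule borel_measurable_caratheodory_compose[OF _ _ assms(3)])
  show "(\<lambda>\<omega>. \<alpha> (T \<omega>) x) \<in> borel_measurable M'" for x
    using assms(1) by (intro measurable_compose[OF assms(2)]) (simp add: random_homeomorphism_def)
  show "continuous_on UNIV (\<alpha> (T \<omega>))" if "\<omega> \<in> space M'" for \<omega>
    using assms(1) measurable_space[OF assms(2) that] by (rule random_homeomorphism_continuous)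
qed

text \<open>The base point is fixed, so the event of the base point is unchanged; off it, \<alpha>
  is a Caratheodory function evaluated at a Borel function.\<close>

lemma random_homeomorphism_measurable_map_option:
  fixes \<alpha> :: "'w \<Rightarrow> 'x::state_space \<Rightarrow> 'y::state_space"
  assumes \<alpha>: "random_homeomorphism M \<alpha>" and T: "T \<in> measurable M' M"
    and h: "h \<in> measurable M' pointed_borel"
  shows "(\<lambda>\<omega>. map_option (\<alpha> (T \<omega>)) (h \<omega>)) \<in> measurable M' pointed_borel"
proof -
  let ?z = "\<lambda>\<omega>. case_option undefined id (h \<omega>)"
  have [measurable]: "{\<omega> \<in> space M'. h \<omega> = None} \<in> sets M'" and z: "?z \<in> borel_measurable M'"
    using h measurable_pointed_borel_iff by blast+
  note random_homeomorphism_measurable_compose[OF \<alpha> T z, measurable]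
  have "(\<lambda>\<omega>. case_option undefined id (map_option (\<alpha> (T \<omega>)) (h \<omega>))) =
      (\<lambda>\<omega>. if h \<omega> = None then undefined else \<alpha> (T \<omega>) (?z \<omega>))"
    by (auto split: option.splits)
  moreover have "\<dots> \<in> borel_measurable M'"
    by measurable
  ultimately show ?thesis
    unfolding measurable_pointed_borel_iff[where c = undefined] by simp
qed

lemma random_homeomorphism_interior:
  assumes "random_homeomorphism M \<alpha>" "\<omega> \<in> space M"
  shows "interior (\<alpha> \<omega> ` A) = \<alpha> \<omega> ` interior A"
  using homeomorphic_map_interior_of[OF random_homeomorphism_homeomorphic_map[OF assms], of A] by simp

lemma random_homeomorphism_closure:
  assumes "random_homeomorphism M \<alpha>" "\<omega> \<in> space M"
  shows "closure (\<alpha> \<omega> ` A) = \<alpha> \<omega> ` closure A"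
  using homeomorphic_map_closure_of[OF random_homeomorphism_homeomorphic_map[OF assms], of A] by simp

lemma random_homeomorphism_interior_of:
  assumes "random_homeomorphism M \<alpha>" "\<omega> \<in> space M" "A \<subseteq> B"
  shows "top_of_set (\<alpha> \<omega> ` B) interior_of (\<alpha> \<omega> ` A) = \<alpha> \<omega> ` (top_of_set B interior_of A)"
  using assms(3)
  by (intro homeomorphic_map_interior_of homeomorphic_map_subtopologies
      random_homeomorphism_homeomorphic_map[OF assms(1,2)]) auto

text \<open>The image meets a ball around x exactly when the Caratheodory function
  \<open>dist x (\<alpha> \<omega> z)\<close> falls below the radius somewhere on
  \<open>N \<omega>\<close>.\<close>

lemma random_compact_image:
  assumes \<alpha>: "random_homeomorphism M \<alpha>" and N: "random_compact M N"
    and N': "\<And>\<omega>. \<omega> \<in> space M \<Longrightarrow> N' \<omega> = \<alpha> \<omega> ` N \<omega>"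
  shows "random_compact M N'"
  unfolding random_compact_iff
proof (intro conjI ballI allI)
  show "compact (N' \<omega>)" if "\<omega> \<in> space M" for \<omega>
    using N that random_homeomorphism_continuous(1)[OF \<alpha> that] unfolding N'[OF that]
    by (auto simp: random_compact_def intro: compact_continuous_image continuous_on_subset)
  have "{\<omega> \<in> space M. \<exists>z\<in>N \<omega>. dist x (\<alpha> \<omega> z) < r} \<in> sets M" for x r
  proof (rule random_compact_sets_ex_less[OF N])
    have [measurable]: "(\<lambda>\<omega>. \<alpha> \<omega> z) \<in> borel_measurable M" for z
      using \<alpha> by (simp add: random_homeomorphism_def)
    show "(\<lambda>\<omega>. dist x (\<alpha> \<omega> z)) \<in> borel_measurable M" for z
      by measurable
    show "continuous_on UNIV (\<lambda>z. dist x (\<alpha> \<omega> z))" if "\<omega> \<in> space M" for \<omega>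
      using random_homeomorphism_continuous(1)[OF \<alpha> that] by (intro continuous_intros)
  qed
  then show "{\<omega> \<in> space M. \<exists>y\<in>N' \<omega>. dist x y < r} \<in> sets M" for x r
    by (simp add: N' cong: conj_cong)
qed

section \<open>Image pairs and their quotient fibers\<close>

definition image_pair ::
  "('w \<Rightarrow> 'x \<Rightarrow> 'y) \<Rightarrow> ('w, 'x) random_pair \<Rightarrow> ('w, 'y) random_pair" where
  "image_pair \<alpha> P = (\<lambda>\<omega>. \<alpha> \<omega> ` fst P \<omega>, \<lambda>\<omega>. \<alpha> \<omega> ` snd P \<omega>)"

lemma regular_random_pair_image:
  assumes \<alpha>: "random_homeomorphism M \<alpha>" and P: "regular_random_pair M P"
  shows "regular_random_pair M (image_pair \<alpha> P)"
proof -
  have "closure (interior (\<alpha> \<omega> ` A)) = \<alpha> \<omega> ` closure (interior A)" if "\<omega> \<in> space M" for \<omega> A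
    using random_homeomorphism_interior[OF \<alpha> that] random_homeomorphism_closure[OF \<alpha> that] by simp
  moreover have "random_compact M (\<lambda>\<omega>. \<alpha> \<omega> ` fst P \<omega>)" "random_compact M (\<lambda>\<omega>. \<alpha> \<omega> ` snd P \<omega>)"
    using P by (auto simp: regular_random_pair_def intro: random_compact_image[OF \<alpha>])
  ultimately show ?thesis
    using P unfolding regular_random_pair_def image_pair_def by (simp add: image_mono)
qed

text \<open>The equivalence between L and L' makes \<open>map_option g\<close> commute with the two
  projections, so preimages of quotient-open sets reduce to preimages under
  \<open>g\<close>.\<close>

lemma continuous_map_pointed_quotient_map_option:
  assumes g: "continuous_on N g" "g \<in> N \<rightarrow> N'" and L: "\<And>x. x \<in> N \<Longrightarrow> g x \<in> L' \<longleftrightarrow> x \<in> L"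
  shows "continuous_map (pointed_quotient N L) (pointed_quotient N' L') (map_option g)"
  unfolding continuous_map_def
proof (intro conjI allI impI)
  show "map_option g \<in> topspace (pointed_quotient N L) \<rightarrow> topspace (pointed_quotient N' L')"
    using g(2) L by (auto simp: topspace_pointed_quotient)
  fix U assume "openin (pointed_quotient N' L') U"
  then have U: "openin (top_of_set N') {y \<in> N'. quotient_proj L' y \<in> U}"
    by (simp add: openin_pointed_quotient)
  have "{x \<in> N. quotient_proj L x \<in> {z \<in> topspace (pointed_quotient N L). map_option g z \<in> U}} =
      N \<inter> g -` {y \<in> N'. quotient_proj L' y \<in> U}"
    using g(2) L by (auto simp: topspace_pointed_quotient quotient_proj_def split: if_splits)
  then show "openin (pointed_quotient N L) {z \<in> topspace (pointed_quotient N L). map_option g z \<in> U}"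
    using continuous_openin_preimage[OF g U]
    by (auto simp: openin_pointed_quotient topspace_pointed_quotient)
qed

lemma continuous_map_fiber_image:
  assumes "random_homeomorphism M \<alpha>" "\<omega> \<in> space M"
  shows "continuous_map (fiber P \<omega>) (fiber (image_pair \<alpha> P) \<omega>) (map_option (\<alpha> \<omega>))"
    and "continuous_map (fiber (image_pair \<alpha> P) \<omega>) (fiber P \<omega>) (map_option (inv (\<alpha> \<omega>)))"
proof -
  have inj: "inj (\<alpha> \<omega>)" and inv: "inv (\<alpha> \<omega>) (\<alpha> \<omega> x) = x" for x
    using random_homeomorphism_bij[OF assms] by (simp_all add: bij_is_inj)
  note cont = random_homeomorphism_continuous[OF assms, THEN continuous_on_subset, OF subset_UNIV]
  show "continuous_map (fiber P \<omega>) (fiber (image_pair \<alpha> P) \<omega>) (map_option (\<alpha> \<omega>))"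
    unfolding fiber_def image_pair_def fst_conv snd_conv
    by (intro continuous_map_pointed_quotient_map_option cont) (auto simp: inj inj_image_mem_iff)
  show "continuous_map (fiber (image_pair \<alpha> P) \<omega>) (fiber P \<omega>) (map_option (inv (\<alpha> \<omega>)))"
    unfolding fiber_def image_pair_def fst_conv snd_conv
    by (intro continuous_map_pointed_quotient_map_option cont)
      (auto simp: inv dest: injD[OF inj])
qed

lemma fiber_image_pair_Some:
  assumes "random_homeomorphism M \<alpha>" "\<omega> \<in> space M"
  shows "Some y \<in> topspace (fiber (image_pair \<alpha> P) \<omega>) \<longleftrightarrow> inv (\<alpha> \<omega>) y \<in> fst P \<omega> - snd P \<omega>"
  using bij_image_Collect_eq[OF random_homeomorphism_bij[OF assms], of "\<lambda>x. x \<in> fst P \<omega>"]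
    bij_image_Collect_eq[OF random_homeomorphism_bij[OF assms], of "\<lambda>x. x \<in> snd P \<omega>"]
  by (auto simp: fiber_def image_pair_def topspace_pointed_quotient)

lemma None_in_fiber [simp]: "None \<in> topspace (fiber P \<omega>)"
  by (simp add: fiber_def topspace_pointed_quotient)

section \<open>Random times along the driving flow\<close>

lemma driving_flow_measurable_pair:
  "driving_flow M \<theta> \<Longrightarrow> (\<lambda>(n, \<omega>). \<theta> n \<omega>) \<in> measurable (count_space UNIV \<Otimes>\<^sub>M M) M"
  unfolding driving_flow_def by blast

lemma driving_flow_0: "driving_flow M \<theta> \<Longrightarrow> \<omega> \<in> space M \<Longrightarrow> \<theta> 0 \<omega> = \<omega>"
  unfolding driving_flow_def by blast

lemma driving_flow_add:
  "driving_flow M \<theta> \<Longrightarrow> \<omega> \<in> space M \<Longrightarrow> \<theta> n (\<theta> m \<omega>) = \<theta> (n + m) \<omega>"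
  unfolding driving_flow_def by metis

lemma driving_flow_measurable:
  assumes "driving_flow M \<theta>" "n \<in> measurable M (count_space UNIV)"
  shows "(\<lambda>\<omega>. \<theta> (n \<omega>) \<omega>) \<in> measurable M M"
proof -
  have "(\<lambda>\<omega>. (n \<omega>, \<omega>)) \<in> measurable M (count_space UNIV \<Otimes>\<^sub>M M)"
    using assms(2) by measurable
  from measurable_compose[OF this driving_flow_measurable_pair[OF assms(1)]] show ?thesis
    unfolding split_conv .
qed

lemma driving_flow_space:
  assumes "driving_flow M \<theta>" "\<omega> \<in> space M"
  shows "\<theta> n \<omega> \<in> space M"
  by (rule measurable_space[OF driving_flow_measurable[OF assms(1), of "\<lambda>_. n"] assms(2)]) simp

text \<open>For \<open>y = Some x\<close> the argument of \<open>f\<close> is the moving point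
  \<open>inv (\<alpha> \<omega>) x\<close>, which lies in
  \<open>fst D \<omega> - snd D \<omega>\<close> on the event to which the statement is
  restricted.\<close>

lemma measurable_fiber_image:
  assumes \<alpha>: "random_homeomorphism M \<alpha>"
    and D: "regular_random_pair M D" and C: "regular_random_pair M C"
    and T: "T \<in> measurable M M"
    and cont: "\<And>\<omega>. \<omega> \<in> space M \<Longrightarrow> continuous_map (fiber D \<omega>) (fiber C (T \<omega>)) (f \<omega>)"
    and meas: "\<And>x. (\<lambda>\<omega>. f \<omega> x) \<in>
      measurable (restrict_space M {\<omega> \<in> space M. x \<in> topspace (fiber D \<omega>)}) pointed_borel"
  shows "(\<lambda>\<omega>. f \<omega> (map_option (inv (\<alpha> \<omega>)) y)) \<in> measurable
    (restrict_space M {\<omega> \<in> space M. y \<in> topspace (fiber (image_pair \<alpha> D) \<omega>)}) pointed_borel"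
proof (cases y)
  case None
  \<comment> \<open>The base point belongs to every fiber, so both restrictions are to all of
    \<open>space M\<close>.\<close>
  then show ?thesis
    using meas[of None] by simp
next
  case (Some x)
  let ?F = "{\<omega> \<in> space M. y \<in> topspace (fiber (image_pair \<alpha> D) \<omega>)}"
  have "?F = {\<omega> \<in> space M. x \<in> fst (image_pair \<alpha> D) \<omega>} - {\<omega> \<in> space M. x \<in> snd (image_pair \<alpha> D) \<omega>}"
    by (auto simp: Some fiber_def topspace_pointed_quotient)
  then have F: "?F \<in> sets M"
    using regular_random_pair_image[OF \<alpha> D]
    by (auto simp: regular_random_pair_def intro!: sets.Diff random_compact_sets_mem)
  have z: "(\<lambda>\<omega>. inv (\<alpha> \<omega>) x) \<in> borel_measurable (restrict_space M ?F)"
    using \<alpha> by (intro measurable_restrict_space1) (simp add: random_homeomorphism_def)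
  have "inv (\<alpha> \<omega>) x \<in> fst D \<omega> - snd D \<omega>" if "\<omega> \<in> ?F" for \<omega>
    using that fiber_image_pair_Some[OF \<alpha>] unfolding Some by blast
  from measurable_fiber_compose[OF D C T cont meas F z this] show ?thesis
    by (simp add: Some)
qed

section \<open>Conjugation of random maps\<close>

definition random_homotopy ::
  "'w measure \<Rightarrow> (int \<Rightarrow> 'w \<Rightarrow> 'w) \<Rightarrow> ('w, 'x::state_space) random_pair \<Rightarrow>
   ('w, 'y::state_space) random_pair \<Rightarrow> ('w \<Rightarrow> nat) \<Rightarrow> (real \<Rightarrow> ('w, 'x, 'y) pointed_map) \<Rightarrow> bool"
  where
  "random_homotopy M \<theta> C D n H \<longleftrightarrow>
     (\<forall>\<omega>\<in>space M. continuous_map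
        (prod_topology (top_of_set {0..1}) (fiber C \<omega>)) (fiber D (\<theta> (int (n \<omega>)) \<omega>))
        (\<lambda>(l, x). H l \<omega> x)) \<and>
     (\<forall>l\<in>{0..1}. \<forall>x. (\<lambda>\<omega>. H l \<omega> x) \<in> measurable
        (restrict_space M {\<omega> \<in> space M. x \<in> topspace (fiber C \<omega>)}) pointed_borel)"

lemma random_homotopic_iff:
  "random_homotopic M \<theta> C D n f g \<longleftrightarrow>
     random_map M \<theta> C D n f \<and> random_map M \<theta> C D n g \<and>
     (\<exists>H. random_homotopy M \<theta> C D n H \<and>
        (\<forall>\<omega>\<in>space M. \<forall>x\<in>topspace (fiber C \<omega>). H 0 \<omega> x = f \<omega> x \<and> H 1 \<omega> x = g \<omega> x))"
  unfolding random_homotopic_def random_homotopy_def by (simp add: conj_assoc)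

text \<open>Conjugates agree with the intended composites only where
  \<open>inv (\<alpha> \<omega>)\<close> is a true inverse, that is on
  \<open>space M\<close>.\<close>

lemma random_map_cong:
  assumes "random_map M \<theta> C D n f" "\<And>\<omega>. \<omega> \<in> space M \<Longrightarrow> f' \<omega> = f \<omega>"
  shows "random_map M \<theta> C D n f'"
proof -
  have "(\<lambda>\<omega>. f' \<omega> x) \<in> measurable
      (restrict_space M {\<omega> \<in> space M. x \<in> topspace (fiber C \<omega>)}) pointed_borel" for x
    by (subst measurable_cong[of _ _ "\<lambda>\<omega>. f \<omega> x"])
      (use assms in \<open>simp_all add: random_map_def space_restrict_space\<close>)
  then show ?thesis
    using assms by (simp add: random_map_def)
qed

lemma random_homotopic_cong:
  assumes "random_homotopic M \<theta> C D n f g"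
    and "\<And>\<omega>. \<omega> \<in> space M \<Longrightarrow> f' \<omega> = f \<omega>" "\<And>\<omega>. \<omega> \<in> space M \<Longrightarrow> g' \<omega> = g \<omega>"
  shows "random_homotopic M \<theta> C D n f' g'"
proof -
  have "random_map M \<theta> C D n f'" "random_map M \<theta> C D n g'"
    using assms random_map_cong unfolding random_homotopic_iff by blast+
  then show ?thesis
    using assms unfolding random_homotopic_iff by simp
qed

text \<open>\<alpha> has to be taken at the random time at which \<open>f\<close> lands, so
  measurability of the shift \<open>n\<close> enters.\<close>

lemma random_map_post_image:
  assumes \<theta>: "driving_flow M \<theta>" and \<alpha>: "random_homeomorphism M \<alpha>"
    and n: "n \<in> measurable M (count_space UNIV)"
    and f: "random_map M \<theta> C D n f"
  shows "random_map M \<theta> C (image_pair \<alpha> D) n (\<lambda>\<omega>. map_option (\<alpha> (\<theta> (int (n \<omega>)) \<omega>)) \<circ> f \<omega>)"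
  unfolding random_map_def
proof (intro conjI ballI allI)
  have T: "(\<lambda>\<omega>. \<theta> (int (n \<omega>)) \<omega>) \<in> measurable M M"
    using n by (intro driving_flow_measurable[OF \<theta>]) measurable
  show "continuous_map (fiber C \<omega>) (fiber (image_pair \<alpha> D) (\<theta> (int (n \<omega>)) \<omega>))
      (map_option (\<alpha> (\<theta> (int (n \<omega>)) \<omega>)) \<circ> f \<omega>)" if "\<omega> \<in> space M" for \<omega>
    using f that driving_flow_space[OF \<theta> that]
    by (auto simp: random_map_def intro: continuous_map_compose continuous_map_fiber_image[OF \<alpha>])
  show "(\<lambda>\<omega>. (map_option (\<alpha> (\<theta> (int (n \<omega>)) \<omega>)) \<circ> f \<omega>) x) \<in> measurable
      (restrict_space M {\<omega> \<in> space M. x \<in> topspace (fiber C \<omega>)}) pointed_borel" for x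
    using f unfolding o_apply random_map_def
    by (intro random_homeomorphism_measurable_map_option[OF \<alpha> measurable_restrict_space1[OF T]]) blast
qed (use f in \<open>simp add: random_map_def\<close>)

lemma random_homotopic_post_image:
  assumes \<theta>: "driving_flow M \<theta>" and \<alpha>: "random_homeomorphism M \<alpha>"
    and n: "n \<in> measurable M (count_space UNIV)"
    and fg: "random_homotopic M \<theta> C D n f g"
  shows "random_homotopic M \<theta> C (image_pair \<alpha> D) n
    (\<lambda>\<omega>. map_option (\<alpha> (\<theta> (int (n \<omega>)) \<omega>)) \<circ> f \<omega>) (\<lambda>\<omega>. map_option (\<alpha> (\<theta> (int (n \<omega>)) \<omega>)) \<circ> g \<omega>)"
proof -
  let ?A = "\<lambda>\<omega>. map_option (\<alpha> (\<theta> (int (n \<omega>)) \<omega>))"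
  have T: "(\<lambda>\<omega>. \<theta> (int (n \<omega>)) \<omega>) \<in> measurable M M"
    using n by (intro driving_flow_measurable[OF \<theta>]) measurable
  obtain H where homotopy: "random_homotopy M \<theta> C D n H"
    and H: "\<And>\<omega> x. \<omega> \<in> space M \<Longrightarrow> x \<in> topspace (fiber C \<omega>) \<Longrightarrow> H 0 \<omega> x = f \<omega> x \<and> H 1 \<omega> x = g \<omega> x"
    using fg unfolding random_homotopic_iff by blast
  have cont: "continuous_map (prod_topology (top_of_set {0..1}) (fiber C \<omega>))
      (fiber D (\<theta> (int (n \<omega>)) \<omega>)) (\<lambda>(l, x). H l \<omega> x)" if "\<omega> \<in> space M" for \<omega>
    using homotopy that unfolding random_homotopy_def by blast
  have meas: "(\<lambda>\<omega>. H l \<omega> x) \<in> measurable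
      (restrict_space M {\<omega> \<in> space M. x \<in> topspace (fiber C \<omega>)}) pointed_borel"
    if "l \<in> {0..1}" for l x
    using homotopy that unfolding random_homotopy_def by blast
  have "continuous_map (prod_topology (top_of_set {0..1}) (fiber C \<omega>))
      (fiber (image_pair \<alpha> D) (\<theta> (int (n \<omega>)) \<omega>)) (\<lambda>(l, x). ?A \<omega> (H l \<omega> x))" if "\<omega> \<in> space M" for \<omega>
    using continuous_map_compose[OF cont[OF that]
        continuous_map_fiber_image(1)[OF \<alpha> driving_flow_space[OF \<theta> that]]]
    by (simp add: o_def case_prod_unfold)
  moreover have "(\<lambda>\<omega>. ?A \<omega> (H l \<omega> x)) \<in> measurable
      (restrict_space M {\<omega> \<in> space M. x \<in> topspace (fiber C \<omega>)}) pointed_borel"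
    if "l \<in> {0..1}" for l x
    by (rule random_homeomorphism_measurable_map_option[OF \<alpha> measurable_restrict_space1[OF T] meas[OF that]])
  ultimately have "random_homotopy M \<theta> C (image_pair \<alpha> D) n (\<lambda>l \<omega> x. ?A \<omega> (H l \<omega> x))"
    unfolding random_homotopy_def by blast
  moreover have "random_map M \<theta> C (image_pair \<alpha> D) n (\<lambda>\<omega>. ?A \<omega> \<circ> f \<omega>)" "random_map M \<theta> C (image_pair \<alpha> D) n (\<lambda>\<omega>. ?A \<omega> \<circ> g \<omega>)"
    using fg random_map_post_image[OF \<theta> \<alpha> n] unfolding random_homotopic_iff by blast+
  ultimately show ?thesis
    unfolding random_homotopic_iff by (intro conjI exI[of _ "\<lambda>l \<omega> x. ?A \<omega> (H l \<omega> x)"]) (simp_all add: H)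
qed

lemma random_map_pre_image:
  assumes \<theta>: "driving_flow M \<theta>" and \<alpha>: "random_homeomorphism M \<alpha>"
    and D: "regular_random_pair M D" and C: "regular_random_pair M C"
    and n: "n \<in> measurable M (count_space UNIV)"
    and f: "random_map M \<theta> D C n f"
  shows "random_map M \<theta> (image_pair \<alpha> D) C n (\<lambda>\<omega>. f \<omega> \<circ> map_option (inv (\<alpha> \<omega>)))"
  unfolding random_map_def
proof (intro conjI ballI allI)
  have T: "(\<lambda>\<omega>. \<theta> (int (n \<omega>)) \<omega>) \<in> measurable M M"
    using n by (intro driving_flow_measurable[OF \<theta>]) measurable
  show "continuous_map (fiber (image_pair \<alpha> D) \<omega>) (fiber C (\<theta> (int (n \<omega>)) \<omega>))
      (f \<omega> \<circ> map_option (inv (\<alpha> \<omega>)))" if "\<omega> \<in> space M" for \<omega>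
    using f that by (auto simp: random_map_def intro: continuous_map_compose continuous_map_fiber_image[OF \<alpha>])
  show "(\<lambda>\<omega>. (f \<omega> \<circ> map_option (inv (\<alpha> \<omega>))) x) \<in> measurable
      (restrict_space M {\<omega> \<in> space M. x \<in> topspace (fiber (image_pair \<alpha> D) \<omega>)}) pointed_borel" for x
    unfolding o_apply by (rule measurable_fiber_image[OF \<alpha> D C T]) (use f in \<open>auto simp: random_map_def\<close>)
qed (use f in \<open>simp add: random_map_def\<close>)

lemma random_homotopic_pre_image:
  assumes \<theta>: "driving_flow M \<theta>" and \<alpha>: "random_homeomorphism M \<alpha>"
    and D: "regular_random_pair M D" and C: "regular_random_pair M C"
    and n: "n \<in> measurable M (count_space UNIV)"
    and fg: "random_homotopic M \<theta> D C n f g"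
  shows "random_homotopic M \<theta> (image_pair \<alpha> D) C n
    (\<lambda>\<omega>. f \<omega> \<circ> map_option (inv (\<alpha> \<omega>))) (\<lambda>\<omega>. g \<omega> \<circ> map_option (inv (\<alpha> \<omega>)))"
proof -
  let ?B = "\<lambda>\<omega>. map_option (inv (\<alpha> \<omega>))" and ?I = "top_of_set {0..1::real}"
  have T: "(\<lambda>\<omega>. \<theta> (int (n \<omega>)) \<omega>) \<in> measurable M M"
    using n by (intro driving_flow_measurable[OF \<theta>]) measurable
  obtain H where homotopy: "random_homotopy M \<theta> D C n H"
    and H: "\<And>\<omega> x. \<omega> \<in> space M \<Longrightarrow> x \<in> topspace (fiber D \<omega>) \<Longrightarrow> H 0 \<omega> x = f \<omega> x \<and> H 1 \<omega> x = g \<omega> x"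
    using fg unfolding random_homotopic_iff by blast
  have cont: "continuous_map (prod_topology (top_of_set {0..1}) (fiber D \<omega>))
      (fiber C (\<theta> (int (n \<omega>)) \<omega>)) (\<lambda>(l, x). H l \<omega> x)" if "\<omega> \<in> space M" for \<omega>
    using homotopy that unfolding random_homotopy_def by blast
  have meas: "(\<lambda>\<omega>. H l \<omega> x) \<in> measurable
      (restrict_space M {\<omega> \<in> space M. x \<in> topspace (fiber D \<omega>)}) pointed_borel"
    if "l \<in> {0..1}" for l x
    using homotopy that unfolding random_homotopy_def by blast
  have "continuous_map (prod_topology ?I (fiber (image_pair \<alpha> D) \<omega>))
      (fiber C (\<theta> (int (n \<omega>)) \<omega>)) (\<lambda>(l, x). H l \<omega> (?B \<omega> x))" if "\<omega> \<in> space M" for \<omega>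
  proof -
    have "continuous_map (prod_topology ?I (fiber (image_pair \<alpha> D) \<omega>))
        (prod_topology ?I (fiber D \<omega>)) (\<lambda>(l, x). (id l, ?B \<omega> x))"
      unfolding continuous_map_prod_top using continuous_map_fiber_image(2)[OF \<alpha> that] by simp
    from continuous_map_compose[OF this cont[OF that]] show ?thesis
      by (simp add: o_def case_prod_unfold)
  qed
  moreover have "(\<lambda>\<omega>. H l \<omega> (?B \<omega> x)) \<in> measurable
      (restrict_space M {\<omega> \<in> space M. x \<in> topspace (fiber (image_pair \<alpha> D) \<omega>)}) pointed_borel"
    if l: "l \<in> {0..1}" for l x
  proof (rule measurable_fiber_image[OF \<alpha> D C T _ meas[OF l]])
    fix \<omega> assume \<omega>: "\<omega> \<in> space M"
    \<comment> \<open>Measurability along a moving point needs continuity of the single slice at l,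
      extracted here from joint continuity.\<close>
    have "continuous_map (fiber D \<omega>) (prod_topology ?I (fiber D \<omega>)) (\<lambda>x. (l, x))"
      using l by (intro continuous_map_pairedI) simp_all
    from continuous_map_compose[OF this cont[OF \<omega>]]
    show "continuous_map (fiber D \<omega>) (fiber C (\<theta> (int (n \<omega>)) \<omega>)) (H l \<omega>)"
      by (simp add: o_def)
  qed
  moreover have B: "?B \<omega> x \<in> topspace (fiber D \<omega>)"
    if "\<omega> \<in> space M" "x \<in> topspace (fiber (image_pair \<alpha> D) \<omega>)" for \<omega> x
    using continuous_map_funspace[OF continuous_map_fiber_image(2)[OF \<alpha> that(1)]] that(2) by blast
  ultimately have "random_homotopy M \<theta> (image_pair \<alpha> D) C n (\<lambda>l \<omega> x. H l \<omega> (?B \<omega> x))"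
    unfolding random_homotopy_def by blast
  moreover have "random_map M \<theta> (image_pair \<alpha> D) C n (\<lambda>\<omega>. f \<omega> \<circ> ?B \<omega>)" "random_map M \<theta> (image_pair \<alpha> D) C n (\<lambda>\<omega>. g \<omega> \<circ> ?B \<omega>)"
    using fg random_map_pre_image[OF \<theta> \<alpha> D C n] unfolding random_homotopic_iff by blast+
  ultimately show ?thesis
    unfolding random_homotopic_iff by (intro conjI exI[of _ "\<lambda>l \<omega> x. H l \<omega> (?B \<omega> x)"]) (simp_all add: H B)
qed

section \<open>Transport of a shift equivalence\<close>

lemma iter_conjugate:
  assumes \<theta>: "driving_flow M \<theta>"
    and d': "\<And>\<omega> x. \<omega> \<in> space M \<Longrightarrow> d' \<omega> (A \<omega> x) = A (\<theta> 1 \<omega>) (d \<omega> x)"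
    and \<omega>: "\<omega> \<in> space M"
  shows "iter \<theta> d' m \<omega> (A \<omega> x) = A (\<theta> (int m) \<omega>) (iter \<theta> d m \<omega> x)"
proof (induction m)
  case 0
  show ?case
    by (simp add: driving_flow_0[OF \<theta> \<omega>])
next
  case (Suc m)
  \<comment> \<open>By induction \<open>A\<close> already stands in front of the first m factors;
    the next factor of \<open>d'\<close> moves it one time step further.\<close>
  have "iter \<theta> d' (Suc m) \<omega> (A \<omega> x) = A (\<theta> 1 (\<theta> (int m) \<omega>)) (d (\<theta> (int m) \<omega>) (iter \<theta> d m \<omega> x))"
    by (simp add: Suc d' driving_flow_space[OF \<theta> \<omega>])
  also have "\<theta> 1 (\<theta> (int m) \<omega>) = \<theta> (int (Suc m)) \<omega>"
    by (simp add: driving_flow_add[OF \<theta> \<omega>])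
  finally show ?case
    by simp
qed

text \<open>\<open>A\<close> is applied at the time where a map lands in P, \<open>B\<close> at the
  time where a map starts there. In composites the inner pairs \<open>B\<close>, \<open>A\<close>
  cancel, so each required homotopy is an old one composed at its ends.\<close>

lemma random_shift_equivalent_image:
  assumes \<theta>: "driving_flow M \<theta>" and \<alpha>: "random_homeomorphism M \<alpha>"
    and equiv: "random_shift_equivalent M \<theta> C c P d"
    and d': "\<And>\<omega> x. \<omega> \<in> space M \<Longrightarrow>
      d' \<omega> x = map_option (\<alpha> (\<theta> 1 \<omega>)) (d \<omega> (map_option (inv (\<alpha> \<omega>)) x))"
  shows "random_shift_equivalent M \<theta> C c (image_pair \<alpha> P) d'"
proof -
  let ?P = "image_pair \<alpha> P"
  define A where "A \<omega> = map_option (\<alpha> \<omega>)" for \<omega>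
  define B where "B \<omega> = map_option (inv (\<alpha> \<omega>))" for \<omega>
  have BA: "B \<omega> (A \<omega> x) = x" if "\<omega> \<in> space M" for \<omega> x
    using random_homeomorphism_bij[OF \<alpha> that]
    by (simp add: A_def B_def option.map_comp o_def bij_is_inj option.map_ident)
  note d' = d'[folded A_def B_def]
  note sp = driving_flow_space[OF \<theta>] and add = driving_flow_add[OF \<theta>]
  note measurable_T = driving_flow_measurable[OF \<theta>]
  have iter: "iter \<theta> d' m \<omega> (A \<omega> x) = A (\<theta> (int m) \<omega>) (iter \<theta> d m \<omega> x)" if "\<omega> \<in> space M" for m \<omega> x
    by (rule iter_conjugate[OF \<theta> _ that]) (simp add: d' BA)
  note post_map = random_map_post_image[OF \<theta> \<alpha>, folded A_def]
    and pre_map = random_map_pre_image[OF \<theta> \<alpha>, folded B_def]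
    and post = random_homotopic_post_image[OF \<theta> \<alpha>, folded A_def]
    and pre = random_homotopic_pre_image[OF \<theta> \<alpha>, folded B_def]
  from equiv obtain n\<^sub>1 n\<^sub>2 r s where C: "regular_random_pair M C" and P: "regular_random_pair M P"
    and c: "random_map M \<theta> C C (\<lambda>_. 1) c" and d: "random_map M \<theta> P P (\<lambda>_. 1) d"
    and n\<^sub>1 [measurable]: "n\<^sub>1 \<in> measurable M (count_space UNIV)"
    and n\<^sub>2 [measurable]: "n\<^sub>2 \<in> measurable M (count_space UNIV)"
    and r: "random_map M \<theta> C P n\<^sub>1 r" and s: "random_map M \<theta> P C n\<^sub>2 s"
    and cd: "intertwines M \<theta> C c P d n\<^sub>1 r" and dc: "intertwines M \<theta> P d C c n\<^sub>2 s"
    and rs: "random_homotopic M \<theta> P P (\<lambda>\<omega>. n\<^sub>2 \<omega> + n\<^sub>1 (\<theta> (int (n\<^sub>2 \<omega>)) \<omega>))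
          (\<lambda>\<omega> x. r (\<theta> (int (n\<^sub>2 \<omega>)) \<omega>) (s \<omega> x))
          (\<lambda>\<omega>. iter \<theta> d (n\<^sub>2 \<omega> + n\<^sub>1 (\<theta> (int (n\<^sub>2 \<omega>)) \<omega>)) \<omega>)"
    and sr: "random_homotopic M \<theta> C C (\<lambda>\<omega>. n\<^sub>1 \<omega> + n\<^sub>2 (\<theta> (int (n\<^sub>1 \<omega>)) \<omega>))
          (\<lambda>\<omega> x. s (\<theta> (int (n\<^sub>1 \<omega>)) \<omega>) (r \<omega> x))
          (\<lambda>\<omega>. iter \<theta> c (n\<^sub>1 \<omega> + n\<^sub>2 (\<theta> (int (n\<^sub>1 \<omega>)) \<omega>)) \<omega>)"
    unfolding random_shift_equivalent_def by (elim conjE exE) (rule that)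
  note P' = regular_random_pair_image[OF \<alpha> P]
  have T: "(\<lambda>\<omega>. n (\<theta> (int (k \<omega>)) \<omega>)) \<in> measurable M (count_space UNIV)"
    if [measurable]: "n \<in> measurable M (count_space UNIV)" "k \<in> measurable M (count_space UNIV)"
    for n k :: "'a \<Rightarrow> nat"
    by (rule measurable_compose[OF measurable_T that(1)]) measurable
  have T1: "(\<lambda>\<omega>. n (\<theta> 1 \<omega>)) \<in> measurable M (count_space UNIV)"
    if [measurable]: "n \<in> measurable M (count_space UNIV)" for n :: "'a \<Rightarrow> nat"
    by (rule measurable_compose[OF measurable_T that]) measurable
  note T1[OF n\<^sub>1, measurable] T1[OF n\<^sub>2, measurable] T[OF n\<^sub>1 n\<^sub>2, measurable]
  define r' where "r' \<omega> x = A (\<theta> (int (n\<^sub>1 \<omega>)) \<omega>) (r \<omega> x)" for \<omega> x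
  define s' where "s' \<omega> x = s \<omega> (B \<omega> x)" for \<omega> x
  have d'_map: "random_map M \<theta> ?P ?P (\<lambda>_. 1) d'"
    by (rule random_map_cong[OF post_map[OF _ pre_map[OF P P _ d]]]) (auto simp: d')
  have r': "random_map M \<theta> C ?P n\<^sub>1 r'"
    by (rule random_map_cong[OF post_map[OF n\<^sub>1 r]]) (auto simp: r'_def)
  have s': "random_map M \<theta> ?P C n\<^sub>2 s'"
    by (rule random_map_cong[OF pre_map[OF P C n\<^sub>2 s]]) (auto simp: s'_def)
  have 1: "intertwines M \<theta> C c ?P d' n\<^sub>1 r'"
    unfolding intertwines_def
  proof (rule random_homotopic_cong[OF post[OF _ cd[unfolded intertwines_def]]])
    fix \<omega> assume \<omega>: "\<omega> \<in> space M"
    let ?m = "n\<^sub>1 (\<theta> 1 \<omega>)"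
    show "(\<lambda>x. iter \<theta> d' (n\<^sub>1 \<omega> - ?m) (\<theta> (int ?m + 1) \<omega>) (r' (\<theta> 1 \<omega>) (c \<omega> x))) =
        A (\<theta> (int (max (n\<^sub>1 \<omega>) ?m + 1)) \<omega>) \<circ>
        (\<lambda>x. iter \<theta> d (n\<^sub>1 \<omega> - ?m) (\<theta> (int ?m + 1) \<omega>) (r (\<theta> 1 \<omega>) (c \<omega> x)))"
    proof
      \<comment> \<open>Truncated subtraction brings the shift \<open>?m\<close> up to the maximum,
        so \<open>A\<close> arrives at the time prescribed by the codomain.\<close>
      have eq: "int (n\<^sub>1 \<omega> - ?m) + (int ?m + 1) = int (max (n\<^sub>1 \<omega>) ?m + 1)"
        by simp_all
      show "iter \<theta> d' (n\<^sub>1 \<omega> - ?m) (\<theta> (int ?m + 1) \<omega>) (r' (\<theta> 1 \<omega>) (c \<omega> x)) =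
          (A (\<theta> (int (max (n\<^sub>1 \<omega>) ?m + 1)) \<omega>) \<circ>
          (\<lambda>x. iter \<theta> d (n\<^sub>1 \<omega> - ?m) (\<theta> (int ?m + 1) \<omega>) (r (\<theta> 1 \<omega>) (c \<omega> x)))) x" for x
        unfolding r'_def add[OF \<omega>] iter[OF sp[OF \<omega>]] o_apply eq ..
    qed
    show "(\<lambda>x. iter \<theta> d' (?m - n\<^sub>1 \<omega>) (\<theta> (int (n\<^sub>1 \<omega>) + 1) \<omega>) (d' (\<theta> (int (n\<^sub>1 \<omega>)) \<omega>) (r' \<omega> x))) =
        A (\<theta> (int (max (n\<^sub>1 \<omega>) ?m + 1)) \<omega>) \<circ>
        (\<lambda>x. iter \<theta> d (?m - n\<^sub>1 \<omega>) (\<theta> (int (n\<^sub>1 \<omega>) + 1) \<omega>) (d (\<theta> (int (n\<^sub>1 \<omega>)) \<omega>) (r \<omega> x)))"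
    proof
      have eq: "1 + int (n\<^sub>1 \<omega>) = int (n\<^sub>1 \<omega>) + 1"
        "int (?m - n\<^sub>1 \<omega>) + (int (n\<^sub>1 \<omega>) + 1) = int (max (n\<^sub>1 \<omega>) ?m + 1)"
        by simp_all
      show "iter \<theta> d' (?m - n\<^sub>1 \<omega>) (\<theta> (int (n\<^sub>1 \<omega>) + 1) \<omega>) (d' (\<theta> (int (n\<^sub>1 \<omega>)) \<omega>) (r' \<omega> x)) =
          (A (\<theta> (int (max (n\<^sub>1 \<omega>) ?m + 1)) \<omega>) \<circ>
          (\<lambda>x. iter \<theta> d (?m - n\<^sub>1 \<omega>) (\<theta> (int (n\<^sub>1 \<omega>) + 1) \<omega>) (d (\<theta> (int (n\<^sub>1 \<omega>)) \<omega>) (r \<omega> x)))) x" for x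
        unfolding r'_def d'[OF sp[OF \<omega>]] BA[OF sp[OF \<omega>]] add[OF \<omega>]
          eq(1) iter[OF sp[OF \<omega>]] o_apply eq(2) ..
    qed
  qed measurable
  \<comment> \<open>The \<open>B\<close> in \<open>s'\<close> at time 1 cancels the \<open>A\<close>
    in \<open>d'\<close>, so both sides are the old ones precomposed with
    \<open>B \<omega>\<close>.\<close>
  have 2: "intertwines M \<theta> ?P d' C c n\<^sub>2 s'"
    unfolding intertwines_def
    by (rule random_homotopic_cong[OF pre[OF P C _ dc[unfolded intertwines_def]]])
      (auto simp: s'_def d' BA sp)
  have 3: "random_homotopic M \<theta> ?P ?P (\<lambda>\<omega>. n\<^sub>2 \<omega> + n\<^sub>1 (\<theta> (int (n\<^sub>2 \<omega>)) \<omega>))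
          (\<lambda>\<omega> x. r' (\<theta> (int (n\<^sub>2 \<omega>)) \<omega>) (s' \<omega> x))
          (\<lambda>\<omega>. iter \<theta> d' (n\<^sub>2 \<omega> + n\<^sub>1 (\<theta> (int (n\<^sub>2 \<omega>)) \<omega>)) \<omega>)"
  \<comment> \<open>Both ends lie in the image pair: \<open>B\<close> acts at the starting time and
    \<open>A\<close> at the final time.\<close>
  proof (rule random_homotopic_cong[OF post[OF _ pre[OF P P _ rs]]])
    fix \<omega> assume \<omega>: "\<omega> \<in> space M"
    let ?n = "n\<^sub>2 \<omega> + n\<^sub>1 (\<theta> (int (n\<^sub>2 \<omega>)) \<omega>)"
    have "int (n\<^sub>1 (\<theta> (int (n\<^sub>2 \<omega>)) \<omega>)) + int (n\<^sub>2 \<omega>) = int ?n"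
      by simp
    then show "(\<lambda>x. r' (\<theta> (int (n\<^sub>2 \<omega>)) \<omega>) (s' \<omega> x)) =
        A (\<theta> (int ?n) \<omega>) \<circ> ((\<lambda>x. r (\<theta> (int (n\<^sub>2 \<omega>)) \<omega>) (s \<omega> x)) \<circ> B \<omega>)"
      unfolding r'_def s'_def add[OF \<omega>] o_def by (simp only:)
    \<comment> \<open>Any argument is thereby of the form \<open>A \<omega> (B \<omega> x)\<close>,
      to which the conjugation of iterates applies.\<close>
    have AB: "A \<omega> (B \<omega> x) = x" for x
      using random_homeomorphism_bij[OF \<alpha> \<omega>]
      by (simp add: A_def B_def option.map_comp o_def bij_is_surj surj_f_inv_f option.map_ident)
    show "iter \<theta> d' ?n \<omega> = A (\<theta> (int ?n) \<omega>) \<circ> (iter \<theta> d ?n \<omega> \<circ> B \<omega>)"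
      using iter[OF \<omega>, of ?n "B \<omega> x" for x] by (auto simp: AB)
  qed measurable
  \<comment> \<open>Both ends lie in C and \<open>B\<close> cancels \<open>A\<close> in the middle,
    so the old homotopy serves unchanged.\<close>
  have 4: "random_homotopic M \<theta> C C (\<lambda>\<omega>. n\<^sub>1 \<omega> + n\<^sub>2 (\<theta> (int (n\<^sub>1 \<omega>)) \<omega>))
          (\<lambda>\<omega> x. s' (\<theta> (int (n\<^sub>1 \<omega>)) \<omega>) (r' \<omega> x))
          (\<lambda>\<omega>. iter \<theta> c (n\<^sub>1 \<omega> + n\<^sub>2 (\<theta> (int (n\<^sub>1 \<omega>)) \<omega>)) \<omega>)"
    by (rule random_homotopic_cong[OF sr]) (simp_all add: r'_def s'_def BA sp)
  show ?thesis
    unfolding random_shift_equivalent_def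
    by (intro conjI exI[of _ n\<^sub>1] exI[of _ n\<^sub>2] exI[of _ r'] exI[of _ s'])
      (fact C P' c d'_map n\<^sub>1 n\<^sub>2 r' s' 1 2 3 4)+
qed

section \<open>Images of isolated invariant sets and filtration pairs\<close>

lemma topologically_equivalent_via_homeomorphism:
  "topologically_equivalent_via M \<theta> \<phi>\<^sub>1 \<phi>\<^sub>2 \<alpha> \<Longrightarrow> random_homeomorphism M \<alpha>"
  unfolding topologically_equivalent_via_def random_homeomorphism_def by blast

lemma topologically_equivalent_via_conjugate:
  "topologically_equivalent_via M \<theta> \<phi>\<^sub>1 \<phi>\<^sub>2 \<alpha> \<Longrightarrow> \<omega> \<in> space M \<Longrightarrow>
    \<phi>\<^sub>2 n \<omega> (\<alpha> \<omega> x) = \<alpha> (\<theta> n \<omega>) (\<phi>\<^sub>1 n \<omega> x)"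
  unfolding topologically_equivalent_via_def by blast

text \<open>The conjugacy is read at \<open>inv (\<alpha> \<omega>) y\<close> and solved for
  \<open>\<phi>\<^sub>1\<close>.\<close>

lemma topologically_equivalent_via_sym:
  assumes \<theta>: "driving_flow M \<theta>" and equiv: "topologically_equivalent_via M \<theta> \<phi>\<^sub>1 \<phi>\<^sub>2 \<alpha>"
  shows "topologically_equivalent_via M \<theta> \<phi>\<^sub>2 \<phi>\<^sub>1 (\<lambda>\<omega>. inv (\<alpha> \<omega>))"
proof -
  note \<alpha> = topologically_equivalent_via_homeomorphism[OF equiv]
  have "\<phi>\<^sub>1 n \<omega> (inv (\<alpha> \<omega>) y) = inv (\<alpha> (\<theta> n \<omega>)) (\<phi>\<^sub>2 n \<omega> y)" if \<omega>: "\<omega> \<in> space M" for n \<omega> y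
  proof -
    have "\<alpha> \<omega> (inv (\<alpha> \<omega>) y) = y"
      using random_homeomorphism_bij[OF \<alpha> \<omega>] by (simp add: bij_is_surj surj_f_inv_f)
    then have "\<phi>\<^sub>2 n \<omega> y = \<alpha> (\<theta> n \<omega>) (\<phi>\<^sub>1 n \<omega> (inv (\<alpha> \<omega>) y))"
      using topologically_equivalent_via_conjugate[OF equiv \<omega>, of n "inv (\<alpha> \<omega>) y"] by simp
    then show ?thesis
      using random_homeomorphism_bij[OF \<alpha> driving_flow_space[OF \<theta> \<omega>]] by (simp add: bij_is_inj)
  qed
  then show ?thesis
    using random_homeomorphism_inv[OF \<alpha>]
    unfolding topologically_equivalent_via_def random_homeomorphism_def by blast
qed

text \<open>An orbit stays in N exactly when its image stays in N', so \<open>Inv\<close> commutes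
  with \<alpha>. N' is prescribed on \<open>space M\<close> only, so that it may be the closure of a
  difference of images, which is an image just there.\<close>

lemma random_isolating_nbhd_of_image:
  assumes \<theta>: "driving_flow M \<theta>" and equiv: "topologically_equivalent_via M \<theta> \<phi>\<^sub>1 \<phi>\<^sub>2 \<alpha>"
    and N: "random_isolating_nbhd_of M \<theta> \<phi>\<^sub>1 S N"
    and N': "\<And>\<omega>. \<omega> \<in> space M \<Longrightarrow> N' \<omega> = \<alpha> \<omega> ` N \<omega>"
    and S': "\<And>\<omega>. \<omega> \<in> space M \<Longrightarrow> S' \<omega> = \<alpha> \<omega> ` S \<omega>"
  shows "random_isolating_nbhd_of M \<theta> \<phi>\<^sub>2 S' N'"
proof -
  note \<alpha> = topologically_equivalent_via_homeomorphism[OF equiv]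
  have Inv: "Inv \<theta> \<phi>\<^sub>2 N' \<omega> = \<alpha> \<omega> ` Inv \<theta> \<phi>\<^sub>1 N \<omega>" if \<omega>: "\<omega> \<in> space M" for \<omega>
  proof -
    have "\<phi>\<^sub>2 n \<omega> (\<alpha> \<omega> x) \<in> N' (\<theta> n \<omega>) \<longleftrightarrow> \<phi>\<^sub>1 n \<omega> x \<in> N (\<theta> n \<omega>)" for n x
      unfolding topologically_equivalent_via_conjugate[OF equiv \<omega>] N'[OF driving_flow_space[OF \<theta> \<omega>]]
      by (rule inj_image_mem_iff[OF bij_is_inj[OF random_homeomorphism_bij[OF \<alpha> driving_flow_space[OF \<theta> \<omega>]]]])
    then show ?thesis
      unfolding Inv_def N'[OF \<omega>] by auto
  qed
  have "random_compact M N'"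
    using N random_compact_image[OF \<alpha> _ N']
    by (simp add: random_isolating_nbhd_of_def random_isolating_nbhd_def)
  then show ?thesis
    using N unfolding random_isolating_nbhd_of_def random_isolating_nbhd_def
    by (simp add: Inv N' S' random_homeomorphism_interior[OF \<alpha>] image_mono)
qed

lemma random_isolated_invariant_image:
  assumes "driving_flow M \<theta>" "topologically_equivalent_via M \<theta> \<phi>\<^sub>1 \<phi>\<^sub>2 \<alpha>"
    and "random_isolated_invariant M \<theta> \<phi>\<^sub>1 S" "\<And>\<omega>. \<omega> \<in> space M \<Longrightarrow> S' \<omega> = \<alpha> \<omega> ` S \<omega>"
  shows "random_isolated_invariant M \<theta> \<phi>\<^sub>2 S'"
  using assms(3) random_isolating_nbhd_of_image[OF assms(1,2) _ refl assms(4)]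
  unfolding random_isolated_invariant_def by blast

lemma random_filtration_pair_image:
  assumes \<theta>: "driving_flow M \<theta>" and equiv: "topologically_equivalent_via M \<theta> \<phi>\<^sub>1 \<phi>\<^sub>2 \<alpha>"
    and P: "random_filtration_pair M \<theta> \<phi>\<^sub>1 S P"
    and S': "\<And>\<omega>. \<omega> \<in> space M \<Longrightarrow> S' \<omega> = \<alpha> \<omega> ` S \<omega>"
  shows "random_filtration_pair M \<theta> \<phi>\<^sub>2 S' (image_pair \<alpha> P)"
proof -
  obtain N L where NL: "P = (N, L)"
    by (cases P)
  let ?N = "\<lambda>\<omega>. \<alpha> \<omega> ` N \<omega>" and ?L = "\<lambda>\<omega>. \<alpha> \<omega> ` L \<omega>"
  note \<alpha> = topologically_equivalent_via_homeomorphism[OF equiv]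
  note conj = topologically_equivalent_via_conjugate[OF equiv]
  note sp = driving_flow_space[OF \<theta>]
  have inj: "inj (\<alpha> \<omega>)" if "\<omega> \<in> space M" for \<omega>
    using random_homeomorphism_bij[OF \<alpha> that] by (rule bij_is_inj)
  have cl: "closure (?N \<omega> - ?L \<omega>) = \<alpha> \<omega> ` closure (N \<omega> - L \<omega>)" if "\<omega> \<in> space M" for \<omega>
    unfolding image_set_diff[OF inj[OF that], symmetric] by (rule random_homeomorphism_closure[OF \<alpha> that])
  from P have N: "random_isolating_nbhd M \<theta> \<phi>\<^sub>1 N" and regular: "regular_random_pair M (N, L)"
    and S: "random_isolated_invariant M \<theta> \<phi>\<^sub>1 S" and SN: "\<And>\<omega>. \<omega> \<in> space M \<Longrightarrow> S \<omega> \<subseteq> N \<omega>"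
    and S_NL: "random_isolating_nbhd_of M \<theta> \<phi>\<^sub>1 S (\<lambda>\<omega>. closure (N \<omega> - L \<omega>))"
    and exit: "\<And>\<omega>. \<omega> \<in> space M \<Longrightarrow> exit_set \<theta> \<phi>\<^sub>1 N \<omega> \<subseteq> top_of_set (N \<omega>) interior_of (L \<omega>)"
    and L: "\<And>\<omega>. \<omega> \<in> space M \<Longrightarrow> \<phi>\<^sub>1 1 \<omega> ` L \<omega> \<inter> closure (N (\<theta> 1 \<omega>) - L (\<theta> 1 \<omega>)) = {}"
    unfolding random_filtration_pair_def NL Let_def fst_conv snd_conv by blast+
  have "random_isolating_nbhd M \<theta> \<phi>\<^sub>2 ?N"
  proof -
    \<comment> \<open>The definition does not say that N isolates S, so the invariant part of N
      takes the place of S.\<close>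
    have "random_isolating_nbhd_of M \<theta> \<phi>\<^sub>1 (Inv \<theta> \<phi>\<^sub>1 N) N"
      using N by (simp add: random_isolating_nbhd_of_def)
    from random_isolating_nbhd_of_image[OF \<theta> equiv this refl refl] show ?thesis
      unfolding random_isolating_nbhd_of_def by blast
  qed
  moreover have "regular_random_pair M (?N, ?L)"
    using regular_random_pair_image[OF \<alpha> regular] by (simp add: image_pair_def)
  moreover have "random_isolated_invariant M \<theta> \<phi>\<^sub>2 S'"
    by (rule random_isolated_invariant_image[OF \<theta> equiv S S'])
  moreover have "\<forall>\<omega>\<in>space M. S' \<omega> \<subseteq> ?N \<omega>"
    using SN by (simp add: S' image_mono)
  moreover have "random_isolating_nbhd_of M \<theta> \<phi>\<^sub>2 S' (\<lambda>\<omega>. closure (?N \<omega> - ?L \<omega>))"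
    by (rule random_isolating_nbhd_of_image[OF \<theta> equiv S_NL cl S'])
  moreover have "exit_set \<theta> \<phi>\<^sub>2 ?N \<omega> \<subseteq> top_of_set (?N \<omega>) interior_of (?L \<omega>)" if \<omega>: "\<omega> \<in> space M" for \<omega>
  proof -
    have "\<phi>\<^sub>2 1 \<omega> (\<alpha> \<omega> x) \<in> interior (?N (\<theta> 1 \<omega>)) \<longleftrightarrow> \<phi>\<^sub>1 1 \<omega> x \<in> interior (N (\<theta> 1 \<omega>))" for x
      unfolding conj[OF \<omega>] random_homeomorphism_interior[OF \<alpha> sp[OF \<omega>]]
      by (rule inj_image_mem_iff[OF inj[OF sp[OF \<omega>]]])
    then have "exit_set \<theta> \<phi>\<^sub>2 ?N \<omega> = \<alpha> \<omega> ` exit_set \<theta> \<phi>\<^sub>1 N \<omega>"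
      unfolding exit_set_def by auto
    also have "\<dots> \<subseteq> \<alpha> \<omega> ` (top_of_set (N \<omega>) interior_of (L \<omega>))"
      by (rule image_mono[OF exit[OF \<omega>]])
    also have "L \<omega> \<subseteq> N \<omega>"
      using regular \<omega> by (simp add: regular_random_pair_def)
    then have "\<alpha> \<omega> ` (top_of_set (N \<omega>) interior_of (L \<omega>)) = top_of_set (?N \<omega>) interior_of (?L \<omega>)"
      by (rule random_homeomorphism_interior_of[OF \<alpha> \<omega>, symmetric])
    finally show ?thesis .
  qed
  moreover have "\<phi>\<^sub>2 1 \<omega> ` ?L \<omega> \<inter> closure (?N (\<theta> 1 \<omega>) - ?L (\<theta> 1 \<omega>)) = {}" if \<omega>: "\<omega> \<in> space M" for \<omega>
  proof -
    have "\<phi>\<^sub>2 1 \<omega> ` ?L \<omega> = \<alpha> (\<theta> 1 \<omega>) ` \<phi>\<^sub>1 1 \<omega> ` L \<omega>"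
      by (simp add: image_image conj[OF \<omega>])
    then show ?thesis
      unfolding cl[OF sp[OF \<omega>]] by (simp add: image_Int[OF inj[OF sp[OF \<omega>]], symmetric] L[OF \<omega>])
  qed
  ultimately show ?thesis
    unfolding random_filtration_pair_def NL image_pair_def Let_def fst_conv snd_conv by blast
qed

section \<open>Equality of the Conley indices\<close>

lemma pointed_space_map_image:
  assumes \<theta>: "driving_flow M \<theta>" and equiv: "topologically_equivalent_via M \<theta> \<phi>\<^sub>1 \<phi>\<^sub>2 \<alpha>"
    and \<omega>: "\<omega> \<in> space M"
  shows "pointed_space_map \<theta> \<phi>\<^sub>2 (image_pair \<alpha> P) \<omega> z =
    map_option (\<alpha> (\<theta> 1 \<omega>)) (pointed_space_map \<theta> \<phi>\<^sub>1 P \<omega> (map_option (inv (\<alpha> \<omega>)) z))"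
proof (cases z)
  case None
  then show ?thesis
    by (simp add: pointed_space_map_def)
next
  case (Some y)
  note \<alpha> = topologically_equivalent_via_homeomorphism[OF equiv]
  have "y = \<alpha> \<omega> (inv (\<alpha> \<omega>) y)"
    using random_homeomorphism_bij[OF \<alpha> \<omega>] by (simp add: bij_is_surj surj_f_inv_f)
  then have "\<phi>\<^sub>2 1 \<omega> y = \<alpha> (\<theta> 1 \<omega>) (\<phi>\<^sub>1 1 \<omega> (inv (\<alpha> \<omega>) y))"
    using topologically_equivalent_via_conjugate[OF equiv \<omega>, of 1 "inv (\<alpha> \<omega>) y"] by simp
  \<comment> \<open>Injectivity at time 1 gives both membership tests, for N and for L, the same
    outcome before and after transport.\<close>
  then show ?thesis
    using bij_is_inj[OF random_homeomorphism_bij[OF \<alpha> driving_flow_space[OF \<theta> \<omega>]]]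
    by (simp add: Some pointed_space_map_def quotient_proj_def image_pair_def inj_image_mem_iff)
qed

text \<open>The member \<open>(C, c)\<close> is kept and only the filtration pair that witnesses it
  is replaced by its image.\<close>

lemma conley_index_image_subset:
  assumes "driving_flow M \<theta>" "topologically_equivalent_via M \<theta> \<phi>\<^sub>1 \<phi>\<^sub>2 \<alpha>"
    and "\<And>\<omega>. \<omega> \<in> space M \<Longrightarrow> S' \<omega> = \<alpha> \<omega> ` S \<omega>"
  shows "conley_index M \<theta> \<phi>\<^sub>1 S \<subseteq> conley_index M \<theta> \<phi>\<^sub>2 S'"
proof -
  have "random_filtration_pair M \<theta> \<phi>\<^sub>2 S' (image_pair \<alpha> P)"
    and "random_shift_equivalent M \<theta> C c (image_pair \<alpha> P) (pointed_space_map \<theta> \<phi>\<^sub>2 (image_pair \<alpha> P))"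
    if "random_filtration_pair M \<theta> \<phi>\<^sub>1 S P"
      and "random_shift_equivalent M \<theta> C c P (pointed_space_map \<theta> \<phi>\<^sub>1 P)"
    for P and C :: "('a, 'd::state_space) random_pair" and c
    using random_filtration_pair_image[OF assms(1,2) that(1) assms(3)]
      random_shift_equivalent_image[OF assms(1) topologically_equivalent_via_homeomorphism[OF assms(2)]
        that(2), where d' = "pointed_space_map \<theta> \<phi>\<^sub>2 (image_pair \<alpha> P)"]
      pointed_space_map_image[OF assms(1,2)] by blast+
  then show ?thesis
    unfolding conley_index_def by blast
qed

theorem lemma2p4:
  fixes M :: "'w measure"
    and \<theta> :: "int \<Rightarrow> 'w \<Rightarrow> 'w"
    and \<phi>\<^sub>1 :: "int \<Rightarrow> 'w \<Rightarrow> 'x \<Rightarrow> 'x::state_space"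
    and \<phi>\<^sub>2 :: "int \<Rightarrow> 'w \<Rightarrow> 'y \<Rightarrow> 'y::state_space"
    and \<alpha> :: "'w \<Rightarrow> 'x \<Rightarrow> 'y"
    and S :: "'w \<Rightarrow> 'x set"
  assumes "driving_flow M \<theta>"
    and "rds M \<theta> \<phi>\<^sub>1"
    and "rds M \<theta> \<phi>\<^sub>2"
    and "topologically_equivalent_via M \<theta> \<phi>\<^sub>1 \<phi>\<^sub>2 \<alpha>"
    and "random_isolated_invariant M \<theta> \<phi>\<^sub>1 S"
  shows "random_isolated_invariant M \<theta> \<phi>\<^sub>2 (\<lambda>\<omega>. \<alpha> \<omega> ` S \<omega>) \<and>
    (conley_index M \<theta> \<phi>\<^sub>1 S ::
       (('w, 'z::state_space) random_pair \<times> ('w, 'z, 'z) pointed_map set) set) =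
    conley_index M \<theta> \<phi>\<^sub>2 (\<lambda>\<omega>. \<alpha> \<omega> ` S \<omega>)"
proof (intro conjI subset_antisym)
  show "random_isolated_invariant M \<theta> \<phi>\<^sub>2 (\<lambda>\<omega>. \<alpha> \<omega> ` S \<omega>)"
    by (rule random_isolated_invariant_image[OF assms(1,4,5) refl])
  show "conley_index M \<theta> \<phi>\<^sub>1 S \<subseteq> conley_index M \<theta> \<phi>\<^sub>2 (\<lambda>\<omega>. \<alpha> \<omega> ` S \<omega>)"
    by (rule conley_index_image_subset[OF assms(1,4) refl])
  \<comment> \<open>The inclusion for the inverse equivalence needs S as an image of the image. Off
    \<open>space M\<close> this may fail, since \<alpha> need not be injective there.\<close>
  have "S \<omega> = inv (\<alpha> \<omega>) ` \<alpha> \<omega> ` S \<omega>" if "\<omega> \<in> space M" for \<omega>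
    using random_homeomorphism_bij[OF topologically_equivalent_via_homeomorphism[OF assms(4)] that]
    by (simp add: bij_is_inj image_inv_f_f)
  then show "conley_index M \<theta> \<phi>\<^sub>2 (\<lambda>\<omega>. \<alpha> \<omega> ` S \<omega>) \<subseteq> conley_index M \<theta> \<phi>\<^sub>1 S"
    by (rule conley_index_image_subset[OF assms(1) topologically_equivalent_via_sym[OF assms(1,4)]])
qed

end
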